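(* Let $f$ be a complex valued strongly additive arithmetic function, i.e. $f(mn)=f(m)+f(n)$ whenever $(m,n)=1$ and $f(p^\alpha)=f(p)$ for every prime $p$ and every integer $\alpha\ge 1$ (so that $f(n)=\sum_{p\mid n}f(p)$). For real $x\ge 0$ put $F(x)=\sum_{1\le m\le x} f(m)$, and for $n\ge 2$ put $$A_n=\Big|\sum_{p\le n}\frac{f(p)}{p}\Big|,\qquad B_n=\sum_{p\le n}\frac{|f(p)|^2}{p},$$ sums over primes $p$. Let $\eta>0$ be the constant defined in the context below. Assume that there exists a nondecreasing function $U:\mathbb N\to\mathbb R^+$ with $\lim_{n\to\infty}U(n)=\infty$ and positive constants $c_1,c_2$ such that $c_1U(n)\le |F(n)|\le c_2U(n)$ for all $n$. Assume further that for some $0<h<1/4$ we have, as $n\to\infty$, $$\sup_{n^h<p\le n}|f(p)| \ll \frac{|F(\eta n)|}{n},\qquad A_{n^h}\ll \frac{|F(\eta n)|}{n},\qquad B_{n^h}^{1/2}\ll \frac{|F(\eta n)|}{n}.$$ Then for every sequence $X,X_1,X_2,\ldots$ of i.i.d. random variables with $\mathbf E|X|<\infty$, $$\lim_{n\to\infty}\frac{\sum_{m=1}^n f(m)X_m}{F(n)} = \mathbf E X\quad\text{almost surely}.$$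
   Context: Let $\{\varepsilon_i, i\ge 1\}$ be i.i.d. random variables on a probability space $(\widetilde\Omega,\widetilde{\mathcal A},\widetilde{\mathbf P})$ with $\widetilde{\mathbf P}\{\varepsilon_i=0\}=\widetilde{\mathbf P}\{\varepsilon_i=1\}=1/2$, and $S_n=\varepsilon_1+\cdots+\varepsilon_n$. Define $$\eta=\sup\Big\{\rho>0:\ \widetilde{\mathbf P}\Big\{\inf_{n\ge1}\frac{S_n}{n}\ge\rho\Big\}>0\Big\}$$ (one has $\eta>0$). The notation $a_n\ll b_n$ means $|a_n|\le C b_n$ for some constant $C$ and all sufficiently large $n$. *)

theory Defs
  imports
    "HOL-Probability.Probability"
    "HOL-Library.Landau_Symbols"
    "HOL-Computational_Algebra.Primes"
begin

definition strongly_additive :: "(nat \<Rightarrow> complex) \<Rightarrow> bool" where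
  "strongly_additive f \<longleftrightarrow>
     (\<forall>m n. 0 < m \<longrightarrow> 0 < n \<longrightarrow> coprime m n \<longrightarrow> f (m * n) = f m + f n) \<and>
     (\<forall>p \<alpha>. prime p \<longrightarrow> 1 \<le> \<alpha> \<longrightarrow> f (p ^ \<alpha>) = f p)"

text \<open>
  The summatory function and the two prime sums take a real bound, since they are
  evaluated at points such as \<open>\<eta> n\<close> and \<open>n\<^sup>h\<close>.
\<close>

definition summatory :: "(nat \<Rightarrow> complex) \<Rightarrow> real \<Rightarrow> complex" where
  "summatory f x = (\<Sum>m | 1 \<le> m \<and> real m \<le> x. f m)"

definition abs_prime_sum :: "(nat \<Rightarrow> complex) \<Rightarrow> real \<Rightarrow> real" where
  "abs_prime_sum f x = cmod (\<Sum>p | prime p \<and> real p \<le> x. f p / of_nat p)"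

definition prime_square_sum :: "(nat \<Rightarrow> complex) \<Rightarrow> real \<Rightarrow> real" where
  "prime_square_sum f x = (\<Sum>p | prime p \<and> real p \<le> x. (cmod (f p))\<^sup>2 / real p)"

text \<open>
  The infimum is taken in the extended reals, where it exists for arbitrary \<open>\<epsilon>\<close>; a variable
  \<open>\<epsilon> i\<close> with \<open>P(\<epsilon> i = 0) = P(\<epsilon> i = 1) = 1/2\<close> may take other values on a null set. The outer
  supremum is a real one: for such \<open>\<epsilon>\<close> the set is bounded above by 1 and nonempty.
\<close>

definition eta :: "'b measure \<Rightarrow> (nat \<Rightarrow> 'b \<Rightarrow> real) \<Rightarrow> real" where
  "eta N \<epsilon> = Sup {\<rho>. 0 < \<rho> \<and>
     0 < measure N {\<omega> \<in> space N.
           ereal \<rho> \<le> (INF n\<in>{1..}. ereal ((\<Sum>i=1..n. \<epsilon> i \<omega>) / real n))}}"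

end

theory Submission
  imports Defs
begin

text \<open>
  The arithmetic input is a second moment bound: splitting \<open>f\<close> at \<open>N\<^sup>h\<close>, the primes below \<open>N\<^sup>h\<close> are
  handled by the Turan-Kubilius inequality, and an integer up to \<open>N\<close> has at most \<open>1 / h\<close> prime divisors
  above \<open>N\<^sup>h\<close>. The hypotheses turn this into \<open>\<Sum>m\<le>N. |f m|\<^sup>2 \<le> C U(n)\<^sup>2 / N\<close> for all \<open>n \<ge> \<eta> N\<close>.
  Since \<open>\<eta> \<le> 3/4 < 1\<close>, by concentration of \<open>S\<^sub>n / n\<close> at \<open>1/2\<close>, the point \<open>n\<close> may be a bit smaller than \<open>N\<close>.

  For the strong law, truncate \<open>X\<^sub>m\<close> at height \<open>m\<close> (independently of the weights). The second moment bound
  makes the variances of the normalized sums summable along \<open>\<lfloor>\<alpha>\<^sup>k\<rfloor>\<close> for every \<open>\<alpha> > 1\<close>. Between consecutive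
  points of this sequence the sums move by at most the sum of \<open>|f m| |Y\<^sub>m|\<close> over the block; the same
  variance estimate applies to \<open>|Y\<^sub>m|\<close>, and by Cauchy-Schwarz the mean is of order
  \<open>sqrt (\<alpha> - 1) U(\<lfloor>\<alpha>\<^sup>k\<rfloor>)\<close>. Letting \<open>\<alpha>\<close> tend to 1 concludes.
\<close>

section \<open>Second moments of strongly additive functions\<close>

text \<open>Strong induction that strips the full power of one prime: the cofactor is coprime to it,
  and \<open>f (p ^ k) = f p\<close> makes the exponent disappear.\<close>

lemma strongly_additive_eq_sum:
  assumes f: "strongly_additive f" and "0 < n"
  shows "f n = (\<Sum>p | prime p \<and> p dvd n. f p)"
  using \<open>0 < n\<close>
proof (induction n rule: less_induct)
  case (less n)
  show ?case
  proof (cases "n = 1")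
    case True
    \<comment> \<open>Additivity at the coprime pair of ones forces \<open>f 1 = 0\<close>, the
      value of the empty sum.\<close>
    have "f (1 * 1) = f 1 + f 1"
      using f unfolding strongly_additive_def by (metis coprime_1_left zero_less_one)
    then show ?thesis using True by (simp cong: conj_cong)
  next
    case False
    then obtain p where p: "prime p" "p dvd n"
      using prime_factor_nat by blast
    obtain m where m: "n = p ^ multiplicity p n * m" "\<not> p dvd m"
      using multiplicity_decompose'[of n p] p less.prems not_prime_unit by blast
    define k where "k = multiplicity p n"
    have k: "1 \<le> k"
      using p less.prems by (simp add: k_def Suc_le_eq prime_multiplicity_gt_zero_iff)
    have nm: "n = p ^ k * m" using m(1) by (simp add: k_def)
    have m0: "0 < m" using nm less.prems by (cases "m = 0") auto
    have pk: "1 < p ^ k" using one_less_power[OF prime_gt_1_nat[OF p(1)], of k] k by simp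
    have "m < n" using nm m0 pk by simp
    have cop: "coprime (p ^ k) m"
      using m(2) p(1) by (simp add: prime_imp_coprime)
    have "f n = f (p ^ k) + f m"
    proof -
      have "0 < p ^ k" using pk by linarith
      then have "f (p ^ k * m) = f (p ^ k) + f m"
        using f cop m0 unfolding strongly_additive_def by blast
      then show ?thesis using nm by simp
    qed
    also have "f (p ^ k) = f p"
      using f p(1) k unfolding strongly_additive_def by blast
    also have "f m = (\<Sum>q | prime q \<and> q dvd m. f q)"
      using less.IH \<open>m < n\<close> m0 by blast
    also have "f p + \<dots> = (\<Sum>q\<in>insert p {q. prime q \<and> q dvd m}. f q)"
      using m0 m(2) by (subst sum.insert) auto
    also have "insert p {q. prime q \<and> q dvd m} = {q. prime q \<and> q dvd n}"
      using p k by (auto simp: nm prime_dvd_mult_iff prime_dvd_power_iff primes_dvd_imp_eq)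
    finally show ?thesis .
  qed
qed

section \<open>Counting common multiples and the Turan-Kubilius upper bound\<close>

lemma card_multiples:
  assumes "0 < (d::nat)"
  shows "card {n \<in> {1..N}. d dvd n} = N div d"
proof -
  have "{n \<in> {1..N}. d dvd n} = (\<lambda>k. d * k) ` {1..N div d}"
  proof (intro equalityI subsetI)
    fix n assume "n \<in> {n \<in> {1..N}. d dvd n}"
    then obtain k where "n = d * k" "1 \<le> n" "n \<le> N" by auto
    moreover have "k \<le> N div d"
      using \<open>n \<le> N\<close> \<open>n = d * k\<close> assms by (simp add: less_eq_div_iff_mult_less_eq mult.commute)
    moreover have "1 \<le> k" using \<open>1 \<le> n\<close> \<open>n = d * k\<close> by (cases k) auto
    ultimately show "n \<in> (\<lambda>k. d * k) ` {1..N div d}" by auto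
  next
    fix n assume "n \<in> (\<lambda>k. d * k) ` {1..N div d}"
    then obtain k where "n = d * k" "1 \<le> k" "k \<le> N div d" by force
    then show "n \<in> {n \<in> {1..N}. d dvd n}"
      using assms by (auto simp: less_eq_div_iff_mult_less_eq mult.commute)
  qed
  then show ?thesis
    using assms by (simp add: card_image inj_on_def)
qed

text \<open>For distinct primes the common multiples are those of \<open>p * q\<close>, and only
  rounding is lost. The main term is kept in product form on the diagonal too, where the true count
  is about \<open>N / p\<close>, so that the main terms of the later double sum factor; the price is
  the extra error \<open>N / p\<close>.\<close>

lemma card_common_multiples_approx:
  assumes "prime p" "prime q"
  shows "\<bar>real (card {n \<in> {1..N}. p dvd n \<and> q dvd n}) - real N / (real p * real q)\<bar>
    \<le> 1 + (if p = q then real N / real p else 0)"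
proof -
  have p: "0 < p" "0 < q" "1 \<le> p" using assms by (auto simp: prime_gt_0_nat Suc_leI)
  have approx: "\<bar>real (N div d) - real N / real d\<bar> \<le> 1" for d
    using floor_divide_of_nat_eq[of N d, where 'a = real] by linarith
  show ?thesis
  proof (cases "p = q")
    case True
    have "{n \<in> {1..N}. p dvd n \<and> q dvd n} = {n \<in> {1..N}. p dvd n}" using True by auto
    then have c: "card {n \<in> {1..N}. p dvd n \<and> q dvd n} = N div p"
      using p by (simp only: card_multiples)
    have "real N / (real p * real p) \<le> real N / real p"
      using p by (intro divide_left_mono) (auto simp: mult_le_cancel_left1)
    moreover have "0 \<le> real N / (real p * real p)" by simp
    moreover have "real (N div p) \<le> real N / real p" by (rule of_nat_div_le_of_nat)
    moreover have "0 \<le> real (N div p)" by simp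
    ultimately have "\<bar>real (N div p) - real N / (real p * real p)\<bar> \<le> 1 + real N / real p"
      by linarith
    then show ?thesis unfolding c using True by simp
  next
    case False
    then have "coprime p q" using assms by (simp add: primes_coprime)
    then have "{n \<in> {1..N}. p dvd n \<and> q dvd n} = {n \<in> {1..N}. p * q dvd n}"
      by (auto simp: divides_mult intro: dvd_mult_left dvd_mult_right)
    then have "card {n \<in> {1..N}. p dvd n \<and> q dvd n} = N div (p * q)"
      using p by (simp only: card_multiples mult_pos_pos)
    then show ?thesis using False approx[of "p * q"] by simp
  qed
qed

text \<open>Expanding the square and exchanging sums leaves counts of common multiples of
  \<open>p\<close> and \<open>q\<close>. Their main terms give \<open>N\<close> times the first
  square. The diagonal errors give \<open>N * B\<close>, and the rounding errors give the square of
  the sum of \<open>cmod (g p)\<close>, which Cauchy-Schwarz and \<open>z * z \<le> N\<close> bound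
  by \<open>N * B\<close> again. The moment is taken about 0 and not about the mean, hence the first
  term.\<close>

lemma turan_kubilius_upper:
  fixes g :: "nat \<Rightarrow> complex"
  assumes fin: "finite P" and P: "\<And>p. p \<in> P \<Longrightarrow> prime p \<and> p \<le> z" and z: "z * z \<le> N"
  shows "(\<Sum>n=1..N. (cmod (\<Sum>p | p \<in> P \<and> p dvd n. g p))\<^sup>2)
    \<le> real N * ((cmod (\<Sum>p\<in>P. g p / of_nat p))\<^sup>2 + 2 * (\<Sum>p\<in>P. (cmod (g p))\<^sup>2 / real p))"
proof -
  define B where "B = (\<Sum>p\<in>P. (cmod (g p))\<^sup>2 / real p)"
  define A where "A = (\<Sum>p\<in>P. g p / of_nat p)"
  define c where "c p q = card {n \<in> {1..N}. p dvd n \<and> q dvd n}" for p q :: nat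
  define d where "d p q = real (c p q) - real N / (real p * real q)" for p q
  have pos: "0 < p" if "p \<in> P" for p using P[OF that] prime_gt_0_nat by blast
  have B0: "0 \<le> B" unfolding B_def by (intro sum_nonneg) auto
  \<comment> \<open>Staying in the complex numbers keeps each summand a product of a factor in
    \<open>p\<close> and a conjugated one in \<open>q\<close>, so that the main term becomes
    \<open>A * cnj A\<close>.\<close>
  have sq: "of_real ((cmod (\<Sum>p | p \<in> P \<and> p dvd n. g p))\<^sup>2)
      = (\<Sum>p\<in>P. \<Sum>q\<in>P. g p * cnj (g q) * (if p dvd n \<and> q dvd n then 1 else 0))" for n
  proof -
    have "(\<Sum>p | p \<in> P \<and> p dvd n. g p) = (\<Sum>p\<in>P. g p * (if p dvd n then 1 else 0))"
      using fin by (intro sum.mono_neutral_cong_left) auto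
    then show ?thesis
      unfolding complex_norm_square
      by (simp add: sum_product) (intro sum.cong refl, auto)
  qed
  have "(of_real (\<Sum>n=1..N. (cmod (\<Sum>p | p \<in> P \<and> p dvd n. g p))\<^sup>2) :: complex)
      = (\<Sum>n=1..N. \<Sum>p\<in>P. \<Sum>q\<in>P. g p * cnj (g q) * (if p dvd n \<and> q dvd n then 1 else 0))"
    unfolding of_real_sum sq ..
  also have "\<dots> = (\<Sum>p\<in>P. \<Sum>q\<in>P. \<Sum>n=1..N. g p * cnj (g q) * (if p dvd n \<and> q dvd n then 1 else 0))"
    by (simp only: sum.swap[where A = "{1..N}" and B = P])
  also have "\<dots> = (\<Sum>p\<in>P. \<Sum>q\<in>P. g p * cnj (g q) * of_nat (c p q))"
  proof (intro sum.cong refl)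
    fix p q
    have "(\<Sum>n=1..N. (if p dvd n \<and> q dvd n then 1 else 0) :: complex) = of_nat (c p q)"
      unfolding c_def by (simp add: sum.If_cases Int_def)
    then show "(\<Sum>n=1..N. g p * cnj (g q) * (if p dvd n \<and> q dvd n then 1 else 0))
        = g p * cnj (g q) * of_nat (c p q)"
      by (simp only: sum_distrib_left[symmetric])
  qed
  also have "\<dots> = (\<Sum>p\<in>P. \<Sum>q\<in>P. of_nat N * (g p / of_nat p * cnj (g q / of_nat q))
      + g p * cnj (g q) * of_real (d p q))"
    by (intro sum.cong refl) (simp add: d_def algebra_simps)
  also have "\<dots> = of_nat N * (A * cnj A) + (\<Sum>p\<in>P. \<Sum>q\<in>P. g p * cnj (g q) * of_real (d p q))"
  proof -
    have "A * cnj A = (\<Sum>p\<in>P. \<Sum>q\<in>P. g p / of_nat p * cnj (g q / of_nat q))"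
      unfolding A_def cnj_sum sum_product ..
    then have "of_nat N * (A * cnj A) = (\<Sum>p\<in>P. \<Sum>q\<in>P. of_nat N * (g p / of_nat p * cnj (g q / of_nat q)))"
      by (simp only: sum_distrib_left)
    then show ?thesis by (simp only: sum.distrib)
  qed
  finally have "(of_real (\<Sum>n=1..N. (cmod (\<Sum>p | p \<in> P \<and> p dvd n. g p))\<^sup>2) :: complex)
      = of_nat N * (A * cnj A) + (\<Sum>p\<in>P. \<Sum>q\<in>P. g p * cnj (g q) * of_real (d p q))" .
  then have "cmod (of_real (\<Sum>n=1..N. (cmod (\<Sum>p | p \<in> P \<and> p dvd n. g p))\<^sup>2))
      \<le> cmod (of_nat N * (A * cnj A)) + cmod (\<Sum>p\<in>P. \<Sum>q\<in>P. g p * cnj (g q) * of_real (d p q))"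
    by (simp only: norm_triangle_ineq)
  moreover have "cmod (of_nat N * (A * cnj A)) = real N * (cmod A)\<^sup>2"
    by (simp add: norm_mult power2_eq_square)
  moreover have "cmod (\<Sum>p\<in>P. \<Sum>q\<in>P. g p * cnj (g q) * of_real (d p q)) \<le> 2 * real N * B"
  proof -
    have "cmod (\<Sum>p\<in>P. \<Sum>q\<in>P. g p * cnj (g q) * of_real (d p q))
        \<le> (\<Sum>p\<in>P. \<Sum>q\<in>P. cmod (g p) * cmod (g q) * (1 + (if p = q then real N / real p else 0)))"
    proof (intro order_trans[OF norm_sum] sum_mono)
      fix p q assume "p \<in> P" "q \<in> P"
      then have "\<bar>d p q\<bar> \<le> 1 + (if p = q then real N / real p else 0)"
        using card_common_multiples_approx[of p q N] P unfolding d_def c_def by blast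
      then show "cmod (g p * cnj (g q) * of_real (d p q))
          \<le> cmod (g p) * cmod (g q) * (1 + (if p = q then real N / real p else 0))"
        unfolding norm_mult complex_mod_cnj norm_of_real by (intro mult_left_mono) simp_all
    qed
    also have "\<dots> = (\<Sum>p\<in>P. \<Sum>q\<in>P. cmod (g p) * cmod (g q))
        + (\<Sum>p\<in>P. \<Sum>q\<in>P. if q = p then cmod (g p) * cmod (g p) * (real N / real p) else 0)"
      unfolding sum.distrib[symmetric] by (intro sum.cong refl) (auto simp: algebra_simps)
    also have "(\<Sum>p\<in>P. \<Sum>q\<in>P. if q = p then cmod (g p) * cmod (g p) * (real N / real p) else 0) = real N * B"
      using fin by (simp add: B_def sum_distrib_left power2_eq_square mult_ac)
    also have "(\<Sum>p\<in>P. \<Sum>q\<in>P. cmod (g p) * cmod (g q)) = (\<Sum>p\<in>P. cmod (g p))\<^sup>2"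
      by (simp add: power2_eq_square sum_product)
    \<comment> \<open>Splitting off \<open>sqrt p\<close> makes Cauchy-Schwarz produce exactly
      \<open>B\<close> and the sum of the primes in \<open>P\<close>.\<close>
    also have "(\<Sum>p\<in>P. cmod (g p)) = (\<Sum>p\<in>P. (cmod (g p) / sqrt (real p)) * sqrt (real p))"
      using pos by (intro sum.cong refl) simp
    also have "\<dots>\<^sup>2 \<le> (\<Sum>p\<in>P. (cmod (g p) / sqrt (real p))\<^sup>2) * (\<Sum>p\<in>P. (sqrt (real p))\<^sup>2)"
      by (rule Cauchy_Schwarz_ineq_sum)
    also have "\<dots> = B * real (\<Sum>p\<in>P. p)"
      by (simp add: B_def power_divide)
    \<comment> \<open>\<open>P\<close> has at most \<open>z\<close> elements, each at most
      \<open>z\<close>, so they add up to at most \<open>z * z\<close>.\<close>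
    also have "\<dots> \<le> B * real N"
    proof -
      have "P \<subseteq> {1..z}" using P pos by (auto simp: Suc_le_eq)
      then have "card P \<le> z" using card_mono[of "{1..z}" P] by simp
      moreover have "(\<Sum>p\<in>P. p) \<le> of_nat (card P) * z"
        by (rule sum_bounded_above) (use P in auto)
      ultimately have "(\<Sum>p\<in>P. p) \<le> N"
        using z mult_le_mono1[of "card P" z z] unfolding of_nat_id by linarith
      then have "real (\<Sum>p\<in>P. p) \<le> real N" by (simp only: of_nat_le_iff)
      then show ?thesis using B0 by (rule mult_left_mono)
    qed
    finally show ?thesis by (simp add: mult_ac)
  qed
  ultimately have "\<bar>\<Sum>n=1..N. (cmod (\<Sum>p | p \<in> P \<and> p dvd n. g p))\<^sup>2\<bar>
      \<le> real N * (cmod A)\<^sup>2 + 2 * real N * B"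
    unfolding norm_of_real by linarith
  then show ?thesis unfolding A_def B_def by (simp add: algebra_simps)
qed

section \<open>Large prime divisors and the second moment of \<open>f\<close>\<close>

text \<open>The full powers of these primes multiply to a divisor of \<open>n\<close>, so
  \<open>N powr h\<close> raised to their number is at most \<open>N\<close>. Comparing exponents
  gives the bound.\<close>

lemma card_large_prime_divisors:
  assumes h: "0 < h" and n: "1 \<le> n" "n \<le> N" and N: "2 \<le> N"
  shows "real (card {p. prime p \<and> p dvd n \<and> real N powr h < real p}) \<le> 1 / h"
proof -
  define Q where "Q = {p. prime p \<and> p dvd n \<and> real N powr h < real p}"
  have Q: "Q \<subseteq> prime_factors n" using n by (auto simp: Q_def prime_factors_dvd)
  then have fin: "finite Q" using finite_subset by blast
  have "(real N powr h) ^ card Q = (\<Prod>p\<in>Q. real N powr h)" by simp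
  also have "\<dots> \<le> (\<Prod>p\<in>Q. real (p ^ multiplicity p n))"
  proof (intro prod_mono conjI)
    fix p assume "p \<in> Q"
    then have "p dvd n" "prime p" "real N powr h < real p" by (auto simp: Q_def)
    moreover have "p ^ 1 \<le> p ^ multiplicity p n"
      using calculation n by (intro power_increasing)
        (auto simp: Suc_le_eq prime_multiplicity_gt_zero_iff prime_gt_0_nat)
    ultimately show "real N powr h \<le> real (p ^ multiplicity p n)"
      by (smt (verit) of_nat_le_iff power_one_right)
  qed simp
  also have "\<dots> = real (\<Prod>p\<in>Q. p ^ multiplicity p n)" by simp
  also have "\<dots> \<le> real (\<Prod>p\<in>prime_factors n. p ^ multiplicity p n)"
  proof -
    have "(\<Prod>p\<in>Q. p ^ multiplicity p n) dvd (\<Prod>p\<in>prime_factors n. p ^ multiplicity p n)"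
      by (rule prod_dvd_prod_subset) (use Q in auto)
    moreover have "(\<Prod>p\<in>prime_factors n. p ^ multiplicity p n) > 0"
      by (intro prod_pos) (meson zero_less_power prime_gt_0_nat in_prime_factors_imp_prime)
    ultimately show ?thesis by (simp only: of_nat_le_iff dvd_imp_le)
  qed
  also have "\<dots> = real n" using n by (subst prod_prime_factors) auto
  also have "\<dots> \<le> real N powr 1" using n by simp
  finally have "(real N powr h) ^ card Q \<le> real N powr 1" .
  moreover have "real N powr (h * real (card Q)) = (real N powr h) ^ card Q"
    using N by (simp only: powr_powr[symmetric]) (simp add: powr_realpow)
  ultimately have "real N powr (h * real (card Q)) \<le> real N powr 1" by simp
  then have "h * real (card Q) \<le> 1" using N by (subst (asm) powr_le_cancel_iff) auto
  then show ?thesis using h unfolding Q_def by (simp add: field_simps)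
qed

text \<open>Each prime above the cut-off \<open>N powr h\<close> costs at most \<open>S\<close>, and
  an integer up to \<open>N\<close> has few of them. The outer factor 2 comes from separating small
  and large primes inside the square.\<close>

lemma strongly_additive_second_moment:
  fixes h S :: real
  assumes f: "strongly_additive f" and h: "0 < h" "h < 1/4" and N: "2 \<le> N"
    and S: "\<And>p. prime p \<Longrightarrow> real N powr h < real p \<Longrightarrow> p \<le> N \<Longrightarrow> cmod (f p) \<le> S" and S0: "0 \<le> S"
  shows "(\<Sum>n=1..N. (cmod (f n))\<^sup>2)
    \<le> 2 * real N * ((abs_prime_sum f (real N powr h))\<^sup>2 + 2 * prime_square_sum f (real N powr h) + (S / h)\<^sup>2)"
proof -
  define y where "y = real N powr h"
  define P where "P = {p. prime p \<and> real p \<le> y}"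
  have Psub: "P \<subseteq> {..nat \<lfloor>y\<rfloor>}" by (auto simp: P_def le_nat_floor)
  have fin: "finite P" using Psub finite_subset by blast
  have y0: "0 \<le> y" by (simp add: y_def)
  \<comment> \<open>The bound on \<open>h\<close> keeps the square of the cut-off below
    \<open>N\<close>; its integer part then serves as \<open>z\<close> in the Turan-Kubilius
    estimate.\<close>
  have "y * y \<le> real N powr 1"
    unfolding y_def using h N by (subst powr_add[symmetric], intro powr_mono) auto
  moreover have "real (nat \<lfloor>y\<rfloor>) * real (nat \<lfloor>y\<rfloor>) \<le> y * y"
    using y0 by (intro mult_mono) auto
  ultimately have "real (nat \<lfloor>y\<rfloor> * nat \<lfloor>y\<rfloor>) \<le> real N"
    by simp
  then have z: "nat \<lfloor>y\<rfloor> * nat \<lfloor>y\<rfloor> \<le> N" by (simp only: of_nat_le_iff)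
  have TK: "(\<Sum>n=1..N. (cmod (\<Sum>p | p \<in> P \<and> p dvd n. f p))\<^sup>2)
      \<le> real N * ((abs_prime_sum f y)\<^sup>2 + 2 * prime_square_sum f y)"
    unfolding abs_prime_sum_def prime_square_sum_def P_def[symmetric]
    by (rule turan_kubilius_upper[OF fin _ z]) (use Psub in \<open>auto simp: P_def\<close>)
  have "(cmod (f n))\<^sup>2 \<le> 2 * (cmod (\<Sum>p | p \<in> P \<and> p dvd n. f p))\<^sup>2 + 2 * (S / h)\<^sup>2"
    if n: "n \<in> {1..N}" for n
  proof -
    have "f n = (\<Sum>p | prime p \<and> p dvd n. f p)"
      using strongly_additive_eq_sum[OF f] n by auto
    also have "{p. prime p \<and> p dvd n} = {p. p \<in> P \<and> p dvd n} \<union> {p. prime p \<and> p dvd n \<and> y < real p}"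
      unfolding P_def set_eq_iff Un_iff mem_Collect_eq not_less[symmetric] by blast
    also have "sum f \<dots> = (\<Sum>p | p \<in> P \<and> p dvd n. f p) + (\<Sum>p | prime p \<and> p dvd n \<and> y < real p. f p)"
      using n fin by (intro sum.union_disjoint) (auto simp: P_def)
    finally have "cmod (f n) \<le> cmod (\<Sum>p | p \<in> P \<and> p dvd n. f p)
        + cmod (\<Sum>p | prime p \<and> p dvd n \<and> y < real p. f p)"
      by (simp only: norm_triangle_ineq)
    also have "cmod (\<Sum>p | prime p \<and> p dvd n \<and> y < real p. f p)
        \<le> real (card {p. prime p \<and> p dvd n \<and> y < real p}) * S"
    proof (rule sum_norm_bound)
      fix p assume "p \<in> {p. prime p \<and> p dvd n \<and> y < real p}"
      then show "cmod (f p) \<le> S"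
        using S[of p] n dvd_imp_le[of p n] unfolding y_def by simp
    qed
    also have "\<dots> \<le> 1 / h * S"
      using card_large_prime_divisors[OF h(1), of n N] n N S0
      by (intro mult_right_mono) (auto simp: y_def)
    finally have *: "cmod (f n) \<le> cmod (\<Sum>p | p \<in> P \<and> p dvd n. f p) + S / h" by simp
    have "(cmod (f n))\<^sup>2 \<le> (cmod (\<Sum>p | p \<in> P \<and> p dvd n. f p) + S / h)\<^sup>2"
      using * by (intro power_mono) auto
    also have "\<dots> \<le> 2 * (cmod (\<Sum>p | p \<in> P \<and> p dvd n. f p))\<^sup>2 + 2 * (S / h)\<^sup>2"
      using sum_squares_bound[of "cmod (\<Sum>p | p \<in> P \<and> p dvd n. f p)" "S / h"]
      unfolding power2_sum by linarith
    finally show ?thesis .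
  qed
  then have "(\<Sum>n=1..N. (cmod (f n))\<^sup>2)
      \<le> (\<Sum>n=1..N. 2 * (cmod (\<Sum>p | p \<in> P \<and> p dvd n. f p))\<^sup>2 + 2 * (S / h)\<^sup>2)"
    by (rule sum_mono)
  also have "\<dots> = 2 * (\<Sum>n=1..N. (cmod (\<Sum>p | p \<in> P \<and> p dvd n. f p))\<^sup>2) + real N * (2 * (S / h)\<^sup>2)"
    by (simp add: sum.distrib sum_distrib_left)
  also have "\<dots> \<le> 2 * (real N * ((abs_prime_sum f y)\<^sup>2 + 2 * prime_square_sum f y)) + real N * (2 * (S / h)\<^sup>2)"
    using TK by linarith
  also have "\<dots> = 2 * real N * ((abs_prime_sum f y)\<^sup>2 + 2 * prime_square_sum f y + (S / h)\<^sup>2)"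
    by (simp only: distrib_left mult.assoc mult.left_commute)
  finally show ?thesis unfolding y_def .
qed

text \<open>All three arithmetic quantities are of order \<open>G N\<close>, so the sum of squares
  is of order \<open>N * (G N)^2\<close>, that is, the square of the summatory function at
  \<open>\<eta> * N\<close> divided by \<open>N\<close>. Monotonicity of \<open>U\<close> allows any
  \<open>n\<close> beyond \<open>\<eta> * N\<close> on the right, a freedom that is used later to
  evaluate \<open>U\<close> at an earlier point than \<open>N\<close>.\<close>

lemma second_moment_bound:
  fixes \<eta> h c\<^sub>2 :: real and U :: "nat \<Rightarrow> real"
  assumes f: "strongly_additive f" and h: "0 < h" "h < 1/4"
    and U: "\<And>n. 1 \<le> n \<Longrightarrow> 0 \<le> U n" "mono_on {1..} U" and c2: "0 < c\<^sub>2"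
    and F: "\<And>n. 1 \<le> n \<Longrightarrow> cmod (summatory f (real n)) \<le> c\<^sub>2 * U n"
    and S: "(\<lambda>n. SUP p\<in>{p. prime p \<and> real n powr h < real p \<and> p \<le> n}. cmod (f p))
           \<in> O(\<lambda>n. cmod (summatory f (\<eta> * real n)) / real n)"
    and A: "(\<lambda>n. abs_prime_sum f (real n powr h)) \<in> O(\<lambda>n. cmod (summatory f (\<eta> * real n)) / real n)"
    and B: "(\<lambda>n. sqrt (prime_square_sum f (real n powr h))) \<in> O(\<lambda>n. cmod (summatory f (\<eta> * real n)) / real n)"
  shows "\<exists>C>0. \<forall>\<^sub>F N in sequentially. \<forall>n\<ge>1. \<eta> * real N \<le> real n \<longrightarrow>
    (\<Sum>m=1..N. (cmod (f m))\<^sup>2) \<le> C * (U n)\<^sup>2 / real N"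
proof -
  define G where "G n = cmod (summatory f (\<eta> * real n)) / real n" for n
  have G0: "0 \<le> G n" for n by (simp add: G_def)
  obtain a where a: "0 < a" "\<forall>\<^sub>F n in sequentially. \<bar>abs_prime_sum f (real n powr h)\<bar> \<le> a * G n"
    using landau_o.bigE[OF A] by (auto simp: G_def)
  obtain b where b: "0 < b" "\<forall>\<^sub>F n in sequentially. \<bar>sqrt (prime_square_sum f (real n powr h))\<bar> \<le> b * G n"
    using landau_o.bigE[OF B] by (auto simp: G_def)
  obtain s where s: "0 < s" "\<forall>\<^sub>F n in sequentially.
      \<bar>SUP p\<in>{p. prime p \<and> real n powr h < real p \<and> p \<le> n}. cmod (f p)\<bar> \<le> s * G n"
    using landau_o.bigE[OF S] by (auto simp: G_def)
  define C where "C = 2 * (a\<^sup>2 + 2 * b\<^sup>2 + (s / h)\<^sup>2) * c\<^sub>2\<^sup>2"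
  have "0 < C" using a(1) c2 by (simp add: C_def add_pos_nonneg)
  moreover have "\<forall>\<^sub>F N in sequentially. \<forall>n\<ge>1. \<eta> * real N \<le> real n \<longrightarrow>
    (\<Sum>m=1..N. (cmod (f m))\<^sup>2) \<le> C * (U n)\<^sup>2 / real N"
    using a(2) b(2) s(2) eventually_ge_at_top[of 2]
  proof eventually_elim
    case (elim N)
    show ?case
    proof (intro allI impI)
      fix n :: nat assume n: "1 \<le> n" "\<eta> * real N \<le> real n"
      have "cmod (summatory f (\<eta> * real N)) \<le> c\<^sub>2 * U n"
      proof (cases "\<eta> * real N < 1")
        \<comment> \<open>This case covers \<open>\<eta> \<le> 0\<close>, which the hypotheses of the lemma allow.\<close>
        case True
        then have *: "{m. 1 \<le> m \<and> real m \<le> \<eta> * real N} = {}" by auto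
        show ?thesis unfolding summatory_def * using c2 U(1)[OF n(1)] by simp
      next
        case False
        define k where "k = nat \<lfloor>\<eta> * real N\<rfloor>"
        have k: "1 \<le> k" using False by (simp add: k_def le_nat_iff)
        \<comment> \<open>The summatory function jumps only at integers, so its real argument may be
          replaced by its integer part \<open>k\<close>, where \<open>F\<close> applies.\<close>
        have "real m \<le> \<eta> * real N \<longleftrightarrow> real m \<le> real k" for m
        proof -
          have k_floor: "\<lfloor>\<eta> * real N\<rfloor> = int k" using False by (simp add: k_def)
          have "real m \<le> \<eta> * real N \<longleftrightarrow> int m \<le> \<lfloor>\<eta> * real N\<rfloor>"
            by (simp add: le_floor_iff)
          then show ?thesis unfolding k_floor by simp
        qed
        then have "summatory f (\<eta> * real N) = summatory f (real k)"
          by (simp add: summatory_def)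
        moreover have "k \<le> n" using n False by (simp add: k_def floor_le_iff nat_le_iff)
        then have "U k \<le> U n" using U(2) k n by (auto simp: mono_on_def)
        then have "c\<^sub>2 * U k \<le> c\<^sub>2 * U n" using c2 by simp
        ultimately show ?thesis using F[OF k] by simp
      qed
      then have "(real N * G N)\<^sup>2 \<le> (c\<^sub>2 * U n)\<^sup>2"
        using elim by (intro power_mono) (auto simp: G_def)
      then have G2: "(G N)\<^sup>2 * (real N)\<^sup>2 \<le> c\<^sub>2\<^sup>2 * (U n)\<^sup>2" by (simp add: power_mult_distrib mult.commute)
      have Bpos: "0 \<le> prime_square_sum f (real N powr h)"
        unfolding prime_square_sum_def by (intro sum_nonneg) auto
      have "(\<Sum>m=1..N. (cmod (f m))\<^sup>2)
        \<le> 2 * real N * ((abs_prime_sum f (real N powr h))\<^sup>2 + 2 * prime_square_sum f (real N powr h) + (s * G N / h)\<^sup>2)"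
      proof (rule strongly_additive_second_moment[OF f h])
        fix p assume "prime p" "real N powr h < real p" "p \<le> N"
        then have "cmod (f p) \<le> (SUP p\<in>{p. prime p \<and> real N powr h < real p \<and> p \<le> N}. cmod (f p))"
          by (intro cSUP_upper bdd_above_finite finite_imageI) auto
        then show "cmod (f p) \<le> s * G N" using elim by linarith
      qed (use elim s G0 in auto)
      also have "\<dots> \<le> 2 * real N * ((a * G N)\<^sup>2 + 2 * (b * G N)\<^sup>2 + (s * G N / h)\<^sup>2)"
      proof (intro mult_left_mono add_mono order_refl)
        show "(abs_prime_sum f (real N powr h))\<^sup>2 \<le> (a * G N)\<^sup>2"
          using elim by (simp add: abs_le_square_iff[symmetric])
        have "(sqrt (prime_square_sum f (real N powr h)))\<^sup>2 \<le> (b * G N)\<^sup>2"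
          using elim by (intro power_mono) (auto simp: Bpos)
        then show "prime_square_sum f (real N powr h) \<le> (b * G N)\<^sup>2" using Bpos by simp
      qed auto
      \<comment> \<open>The outer factor \<open>N\<close> is written as its square over
        \<open>N\<close>, so that the bound \<open>G2\<close> on the product of squares becomes
        applicable.\<close>
      also have "\<dots> = 2 * (a\<^sup>2 + 2 * b\<^sup>2 + (s / h)\<^sup>2) * ((G N)\<^sup>2 * (real N)\<^sup>2) / real N"
      proof -
        have N2: "(real N)\<^sup>2 / real N = real N" using elim by (simp add: power2_eq_square)
        have sh: "(s * G N / h)\<^sup>2 = (s / h)\<^sup>2 * (G N)\<^sup>2" by (simp add: power_divide power_mult_distrib)
        show ?thesis
          unfolding times_divide_eq_right[symmetric, of _ "_ * (real N)\<^sup>2"]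
            times_divide_eq_right[symmetric, of _ "(real N)\<^sup>2"] N2 sh power_mult_distrib
          by (simp only: distrib_left distrib_right mult.assoc mult.commute mult.left_commute)
      qed
      also have "\<dots> \<le> 2 * (a\<^sup>2 + 2 * b\<^sup>2 + (s / h)\<^sup>2) * (c\<^sub>2\<^sup>2 * (U n)\<^sup>2) / real N"
        by (intro divide_right_mono mult_left_mono G2) auto
      finally show "(\<Sum>m=1..N. (cmod (f m))\<^sup>2) \<le> C * (U n)\<^sup>2 / real N"
        by (simp add: C_def mult_ac)
    qed
  qed
  ultimately show ?thesis by blast
qed

section \<open>A strong law for complex weights\<close>

definition truncate :: "nat \<Rightarrow> real \<Rightarrow> real" where
  "truncate m x = (if \<bar>x\<bar> \<le> real m then x else 0)"

lemma truncate_measurable [measurable]: "truncate m \<in> borel_measurable borel"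
  unfolding truncate_def by measurable

lemma abs_truncate_le: "\<bar>truncate m x\<bar> \<le> real m" "\<bar>truncate m x\<bar> \<le> \<bar>x\<bar>"
  by (auto simp: truncate_def)

lemma truncate_square_mono: "m \<le> n \<Longrightarrow> (truncate m x)\<^sup>2 \<le> (truncate n x)\<^sup>2"
  by (auto simp: truncate_def)

text \<open>Integrated over \<open>\<bar>X\<bar>\<close>, this bounds the sum of the tail
  probabilities by the first moment. The bound by \<open>K\<close> is carried along to close the
  induction: when the new term is 1, both \<open>Suc K\<close> and \<open>x\<close> still leave room
  for it.\<close>

lemma sum_indicator_less_le:
  fixes x :: real
  assumes "0 \<le> x"
  shows "(\<Sum>m<K. if real (Suc m) < x then 1 else 0) \<le> min (real K) x"
proof (induction K)
  case (Suc K)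
  then show ?case by (cases "real (Suc K) < x") auto
qed (use assms in auto)

text \<open>Only levels of at least \<open>\<bar>x\<bar>\<close> contribute, and there the terms
  decay geometrically from about the square of \<open>x\<close> divided by
  \<open>\<bar>x\<bar>\<close>. This is how a first moment comes to control the sum of truncated
  second moments.\<close>

lemma sum_truncate_geometric_le:
  fixes x \<alpha> :: real
  assumes \<alpha>: "1 < \<alpha>"
  shows "(\<Sum>k<K. (truncate (nat \<lfloor>\<alpha> ^ k\<rfloor>) x)\<^sup>2 / real (nat \<lfloor>\<alpha> ^ k\<rfloor>)) \<le> 2 * \<alpha> / (\<alpha> - 1) * \<bar>x\<bar>"
proof (cases "x = 0")
  case True
  then show ?thesis by (simp add: truncate_def)
next
  case False
  \<comment> \<open>The summand at \<open>k\<close> is dominated by a multiple of \<open>g k - g (Suc k)\<close>, so the sum telescopes.\<close>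
  define g where "g k = min (1 / \<bar>x\<bar>) (1 / \<alpha> ^ k)" for k
  define c where "c = 2 * x\<^sup>2 * (\<alpha> / (\<alpha> - 1))"
  have c0: "0 \<le> c" using \<alpha> by (simp add: c_def)
  have "(truncate (nat \<lfloor>\<alpha> ^ k\<rfloor>) x)\<^sup>2 / real (nat \<lfloor>\<alpha> ^ k\<rfloor>) \<le> c * (g k - g (Suc k))" for k
  proof -
    have a1: "1 \<le> \<alpha> ^ k" using \<alpha> by (simp add: one_le_power)
    have dec: "1 / \<alpha> ^ Suc k \<le> 1 / \<alpha> ^ k"
      using \<alpha> by (intro divide_left_mono power_increasing) auto
    have "1 \<le> \<lfloor>\<alpha> ^ k\<rfloor>" using a1 by simp
    then have "1 \<le> real (nat \<lfloor>\<alpha> ^ k\<rfloor>)" "\<alpha> ^ k < real (nat \<lfloor>\<alpha> ^ k\<rfloor>) + 1"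
      by (simp, linarith)
    \<comment> \<open>The floor of a number that is at least 1 is at least half of it; this costs
      the factor 2 in \<open>c\<close>.\<close>
    then have fl: "real (nat \<lfloor>\<alpha> ^ k\<rfloor>) \<le> \<alpha> ^ k" "\<alpha> ^ k / 2 \<le> real (nat \<lfloor>\<alpha> ^ k\<rfloor>)"
      using a1 by linarith+
    show ?thesis
    proof (cases "\<bar>x\<bar> \<le> real (nat \<lfloor>\<alpha> ^ k\<rfloor>)")
      case True
      then have "\<bar>x\<bar> \<le> \<alpha> ^ k" using fl by linarith
      then have "1 / \<alpha> ^ k \<le> 1 / \<bar>x\<bar>" using False \<alpha> by (intro divide_left_mono) auto
      then have "g k - g (Suc k) = 1 / \<alpha> ^ k - 1 / \<alpha> ^ Suc k"
        unfolding g_def using dec by linarith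
      also have "\<dots> = (\<alpha> - 1) / \<alpha> / \<alpha> ^ k"
        using \<alpha> by (simp add: field_simps)
      finally have "c * (g k - g (Suc k)) = x\<^sup>2 / (\<alpha> ^ k / 2)"
        using \<alpha> by (simp add: c_def)
      moreover have "x\<^sup>2 / real (nat \<lfloor>\<alpha> ^ k\<rfloor>) \<le> x\<^sup>2 / (\<alpha> ^ k / 2)"
        using fl a1 by (intro divide_left_mono) auto
      ultimately show ?thesis using True by (simp add: truncate_def)
    next
      case x: False
      have "g (Suc k) \<le> g k" using dec by (auto simp: g_def min_def)
      then show ?thesis using x c0 by (simp add: truncate_def)
    qed
  qed
  then have "(\<Sum>k<K. (truncate (nat \<lfloor>\<alpha> ^ k\<rfloor>) x)\<^sup>2 / real (nat \<lfloor>\<alpha> ^ k\<rfloor>)) \<le> (\<Sum>k<K. c * (g k - g (Suc k)))"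
    by (rule sum_mono)
  also have "\<dots> = c * (g 0 - g K)"
    by (simp only: sum_distrib_left[symmetric] sum_lessThan_telescope')
  also have "\<dots> \<le> c * (1 / \<bar>x\<bar>)"
  proof (rule mult_left_mono[OF _ c0])
    have "0 \<le> g K" "g 0 \<le> 1 / \<bar>x\<bar>" using \<alpha> by (auto simp: g_def)
    then show "g 0 - g K \<le> 1 / \<bar>x\<bar>" by linarith
  qed
  also have "\<dots> = 2 * \<alpha> / (\<alpha> - 1) * \<bar>x\<bar>"
  proof -
    have "x\<^sup>2 / \<bar>x\<bar> = \<bar>x\<bar>" using False by (simp add: power2_eq_square abs_if)
    then show ?thesis unfolding c_def by (metis (no_types, opaque_lifting) mult.commute mult.left_commute mult.right_neutral times_divide_eq_left times_divide_eq_right)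
  qed
  finally show ?thesis .
qed

section \<open>Variances and almost sure convergence along a subsequence\<close>

text \<open>Independence removes the covariances, and each remaining variance is at most the
  uncentred second moment. Boundedness supplies the integrability of all products.\<close>

lemma (in prob_space) expectation_square_sum_indep_le:
  fixes W :: "nat \<Rightarrow> 'a \<Rightarrow> real"
  assumes indep: "indep_vars (\<lambda>_. borel) W I" and fin: "finite I"
    and bnd: "\<And>i x. i \<in> I \<Longrightarrow> \<bar>W i x\<bar> \<le> b i"
  shows "expectation (\<lambda>x. (\<Sum>i\<in>I. w i * (W i x - expectation (W i)))\<^sup>2)
      \<le> (\<Sum>i\<in>I. (w i)\<^sup>2 * expectation (\<lambda>x. (W i x)\<^sup>2))"
proof -
  define Z where "Z i x = W i x - expectation (W i)" for i x
  have meas: "W i \<in> borel_measurable M" if "i \<in> I" for i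
    using indep that unfolding indep_vars_def by auto
  then have measZ [measurable]: "Z i \<in> borel_measurable M" if "i \<in> I" for i
    unfolding Z_def using that by measurable
  have W_int: "integrable M (W i)" if "i \<in> I" for i
    by (rule integrable_const_bound[where B = "b i"]) (use that bnd meas in auto)
  have W2_int: "integrable M (\<lambda>x. (W i x)\<^sup>2)" if "i \<in> I" for i
  proof (rule integrable_const_bound[where B = "(b i)\<^sup>2"])
    show "AE x in M. norm ((W i x)\<^sup>2) \<le> (b i)\<^sup>2"
      using that bnd by (intro AE_I2) (simp add: abs_le_square_iff[symmetric], smt (verit))
  qed (use that meas in measurable)
  have Z_bnd: "\<bar>Z i x\<bar> \<le> b i + \<bar>expectation (W i)\<bar>" if "i \<in> I" for i x
    using bnd[OF that, of x] by (simp add: Z_def)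
  have Z_int: "integrable M (Z i)" if "i \<in> I" for i
    unfolding Z_def using W_int[OF that] by simp
  have ZZ_int: "integrable M (\<lambda>x. Z i x * Z j x)" if "i \<in> I" "j \<in> I" for i j
  proof (rule integrable_const_bound)
    show "AE x in M. norm (Z i x * Z j x) \<le> (b i + \<bar>expectation (W i)\<bar>) * (b j + \<bar>expectation (W j)\<bar>)"
      unfolding real_norm_def abs_mult
      by (intro AE_I2 mult_mono Z_bnd that) (use Z_bnd[OF that(1)] in \<open>auto intro: order_trans[OF abs_ge_zero]\<close>)
  qed (use that measZ in measurable)
  have Z_mean: "expectation (Z i) = 0" if "i \<in> I" for i
    unfolding Z_def using W_int[OF that] by (simp add: prob_space)
  have indepZ: "indep_vars (\<lambda>_. borel) Z I"
    unfolding Z_def by (rule indep_vars_compose2[OF indep]) auto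
  have cov: "expectation (\<lambda>x. Z i x * Z j x) = 0" if "i \<in> I" "j \<in> I" "i \<noteq> j" for i j
  proof -
    have "expectation (\<lambda>x. \<Prod>k\<in>{i,j}. Z k x) = (\<Prod>k\<in>{i,j}. expectation (Z k))"
      by (rule indep_vars_lebesgue_integral) (use that Z_int indep_vars_subset[OF indepZ] in auto)
    then show ?thesis using that Z_mean by simp
  qed
  have "expectation (\<lambda>x. (\<Sum>i\<in>I. w i * Z i x)\<^sup>2)
      = expectation (\<lambda>x. \<Sum>i\<in>I. \<Sum>j\<in>I. w i * w j * (Z i x * Z j x))"
    by (simp add: power2_eq_square sum_product mult_ac)
  also have "\<dots> = (\<Sum>i\<in>I. \<Sum>j\<in>I. w i * w j * expectation (\<lambda>x. Z i x * Z j x))"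
    using ZZ_int by (simp add: Bochner_Integration.integral_sum)
  also have "\<dots> = (\<Sum>i\<in>I. (w i)\<^sup>2 * expectation (\<lambda>x. (Z i x)\<^sup>2))"
  proof (rule sum.cong[OF refl])
    fix i assume i: "i \<in> I"
    have "(\<Sum>j\<in>I. w i * w j * expectation (\<lambda>x. Z i x * Z j x))
        = (\<Sum>j\<in>I. if j = i then (w i)\<^sup>2 * expectation (\<lambda>x. (Z i x)\<^sup>2) else 0)"
      using cov[OF i] by (intro sum.cong refl) (auto simp: power2_eq_square)
    then show "(\<Sum>j\<in>I. w i * w j * expectation (\<lambda>x. Z i x * Z j x)) = (w i)\<^sup>2 * expectation (\<lambda>x. (Z i x)\<^sup>2)"
      using fin i by simp
  qed
  also have "\<dots> \<le> (\<Sum>i\<in>I. (w i)\<^sup>2 * expectation (\<lambda>x. (W i x)\<^sup>2))"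
  proof (intro sum_mono mult_left_mono)
    fix i assume "i \<in> I"
    then show "expectation (\<lambda>x. (Z i x)\<^sup>2) \<le> expectation (\<lambda>x. (W i x)\<^sup>2)"
      using variance_eq[OF W_int W2_int] unfolding Z_def by simp
  qed simp
  finally show ?thesis unfolding Z_def .
qed

text \<open>The series of the squares has finite integral by monotone convergence, so it converges
  almost everywhere and its terms tend to 0.\<close>

lemma AE_tendsto_0_of_summable_square:
  fixes T :: "nat \<Rightarrow> 'a \<Rightarrow> real"
  assumes int: "\<And>k. integrable M (\<lambda>x. (T k x)\<^sup>2)"
    and sum: "summable (\<lambda>k. integral\<^sup>L M (\<lambda>x. (T k x)\<^sup>2))"
  shows "AE x in M. (\<lambda>k. T k x) \<longlonglongrightarrow> 0"
proof -
  have [measurable]: "(\<lambda>x. (T k x)\<^sup>2) \<in> borel_measurable M" for k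
    using int by auto
  have "(\<integral>\<^sup>+x. (\<Sum>k. ennreal ((T k x)\<^sup>2)) \<partial>M) = (\<Sum>k. \<integral>\<^sup>+x. ennreal ((T k x)\<^sup>2) \<partial>M)"
    by (rule nn_integral_suminf) measurable
  also have "\<dots> = (\<Sum>k. ennreal (integral\<^sup>L M (\<lambda>x. (T k x)\<^sup>2)))"
    using int by (simp add: nn_integral_eq_integral)
  also have "\<dots> = ennreal (\<Sum>k. integral\<^sup>L M (\<lambda>x. (T k x)\<^sup>2))"
    by (rule suminf_ennreal2) (use sum in auto)
  finally have "(\<integral>\<^sup>+x. (\<Sum>k. ennreal ((T k x)\<^sup>2)) \<partial>M) \<noteq> \<infinity>" by simp
  then have "AE x in M. (\<Sum>k. ennreal ((T k x)\<^sup>2)) \<noteq> \<infinity>"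
    by (rule nn_integral_PInf_AE[rotated]) measurable
  then show ?thesis
  proof eventually_elim
    case (elim x)
    then have "summable (\<lambda>k. (T k x)\<^sup>2)"
      by (intro summable_suminf_not_top) auto
    then have "(\<lambda>k. (T k x)\<^sup>2) \<longlonglongrightarrow> 0" by (rule summable_LIMSEQ_zero)
    then have "(\<lambda>k. sqrt ((T k x)\<^sup>2)) \<longlonglongrightarrow> sqrt 0" by (rule tendsto_real_sqrt)
    then show ?case by (simp add: tendsto_rabs_zero_iff)
  qed
qed

text \<open>The second moments up to index \<open>N k\<close> are all at most
  \<open>v (N k)\<close>, so the normalized sum has variance at most a constant times
  \<open>v (N k) / N k\<close>, which is summable. The normalizer \<open>u k\<close> is independent
  of \<open>N k\<close> because sums up to the right end of a block will be divided by
  \<open>U\<close> at its left end.\<close>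

lemma (in prob_space) AE_subsequence_fluctuation:
  fixes W :: "nat \<Rightarrow> 'a \<Rightarrow> real" and N :: "nat \<Rightarrow> nat"
  assumes indep: "indep_vars (\<lambda>_. borel) W {1..}"
    and bnd: "\<And>i x. \<bar>W i x\<bar> \<le> b i"
    and v: "\<And>m n. 1 \<le> m \<Longrightarrow> m \<le> n \<Longrightarrow> expectation (\<lambda>x. (W m x)\<^sup>2) \<le> v n"
    and w: "\<forall>\<^sub>F k in sequentially. (\<Sum>m=1..N k. (w m)\<^sup>2) \<le> C * (u k)\<^sup>2 / real (N k)"
    and sum: "summable (\<lambda>k. v (N k) / real (N k))"
    and v0: "\<And>n. 0 \<le> v n"
  shows "AE x in M. (\<lambda>k. (\<Sum>m=1..N k. w m * (W m x - expectation (W m))) / u k) \<longlonglongrightarrow> 0"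
proof (rule AE_tendsto_0_of_summable_square)
  define T where "T k x = (\<Sum>m=1..N k. w m * (W m x - expectation (W m)))" for k x
  have meas: "W i \<in> borel_measurable M" if "1 \<le> i" for i
    using indep that unfolding indep_vars_def by auto
  have measT [measurable]: "T k \<in> borel_measurable M" for k
    unfolding T_def by (intro borel_measurable_sum borel_measurable_times borel_measurable_diff meas) auto
  have "\<bar>T k x\<bar> \<le> (\<Sum>m=1..N k. \<bar>w m\<bar> * (b m + \<bar>expectation (W m)\<bar>))" for k x
    unfolding T_def
  proof (intro order_trans[OF sum_abs] sum_mono)
    fix m show "\<bar>w m * (W m x - expectation (W m))\<bar> \<le> \<bar>w m\<bar> * (b m + \<bar>expectation (W m)\<bar>)"
      unfolding abs_mult using bnd[of m x] by (intro mult_left_mono) auto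
  qed
  then have T2: "(T k x)\<^sup>2 \<le> (\<Sum>m=1..N k. \<bar>w m\<bar> * (b m + \<bar>expectation (W m)\<bar>))\<^sup>2" for k x
    by (metis abs_ge_zero power2_abs power_mono)
  have intT: "integrable M (\<lambda>x. (T k x)\<^sup>2)" for k
    by (rule integrable_const_bound[where B = "(\<Sum>m=1..N k. \<bar>w m\<bar> * (b m + \<bar>expectation (W m)\<bar>))\<^sup>2"])
      (use T2 in auto)
  then show "integrable M (\<lambda>x. ((\<Sum>m=1..N k. w m * (W m x - expectation (W m))) / u k)\<^sup>2)" for k
    unfolding T_def[symmetric] power_divide by simp
  have "expectation (\<lambda>x. (T k x / u k)\<^sup>2) \<le> \<bar>C\<bar> * (v (N k) / real (N k))"
    if "(\<Sum>m=1..N k. (w m)\<^sup>2) \<le> C * (u k)\<^sup>2 / real (N k)" for k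
  proof -
    have "expectation (\<lambda>x. (T k x)\<^sup>2) \<le> (\<Sum>m=1..N k. (w m)\<^sup>2 * expectation (\<lambda>x. (W m x)\<^sup>2))"
      unfolding T_def
      by (rule expectation_square_sum_indep_le) (use bnd in \<open>auto intro!: indep_vars_subset[OF indep]\<close>)
    also have "\<dots> \<le> (\<Sum>m=1..N k. (w m)\<^sup>2 * v (N k))"
      by (intro sum_mono mult_left_mono v) auto
    also have "\<dots> \<le> C * (u k)\<^sup>2 / real (N k) * v (N k)"
      using mult_right_mono[OF that v0] by (simp add: sum_distrib_right)
    also have "\<dots> \<le> \<bar>C\<bar> * (u k)\<^sup>2 / real (N k) * v (N k)"
      by (intro mult_right_mono divide_right_mono v0) auto
    finally have *: "expectation (\<lambda>x. (T k x)\<^sup>2) \<le> \<bar>C\<bar> * (v (N k) / real (N k)) * (u k)\<^sup>2"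
      by (simp add: mult_ac)
    show ?thesis
    \<comment> \<open>If \<open>u k = 0\<close>, the quotient is 0 by the convention for division by
      zero; otherwise \<open>*\<close> can be divided by the square of \<open>u k\<close>.\<close>
    proof (cases "u k = 0")
      case False
      then show ?thesis using * by (simp add: power_divide pos_divide_le_eq)
    qed (use v0 in simp)
  qed
  then have "\<forall>\<^sub>F k in sequentially. norm (expectation (\<lambda>x. (T k x / u k)\<^sup>2)) \<le> \<bar>C\<bar> * (v (N k) / real (N k))"
    using w by (auto elim!: eventually_mono)
  moreover have "summable (\<lambda>k. \<bar>C\<bar> * (v (N k) / real (N k)))"
    using sum by (rule summable_mult)
  ultimately show "summable (\<lambda>k. expectation (\<lambda>x. ((\<Sum>m=1..N k. w m * (W m x - expectation (W m))) / u k)\<^sup>2))"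
    unfolding T_def[symmetric]
    by (rule summable_comparison_test_ev)
qed

section \<open>Weighted averages and interpolation between geometric points\<close>

text \<open>Past some \<open>m0\<close> the values of \<open>e\<close> are at most a small
  \<open>d\<close>, and the total weight is at most \<open>D * U n\<close>; the part up to
  \<open>m0\<close> is a fixed number, negligible since \<open>U\<close> tends to infinity.\<close>

lemma toeplitz_tendsto_0:
  fixes r e :: "nat \<Rightarrow> real" and U :: "nat \<Rightarrow> real"
  assumes r0: "\<And>m. 0 \<le> r m" and D: "\<forall>\<^sub>F n in sequentially. (\<Sum>m=1..n. r m) \<le> D * U n"
    and U: "filterlim U at_top sequentially" and e: "e \<longlonglongrightarrow> 0" 
  shows "(\<lambda>n. (\<Sum>m=1..n. r m * \<bar>e m\<bar>) / U n) \<longlonglongrightarrow> 0"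
proof (rule LIMSEQ_I)
  fix \<delta> :: real assume \<delta>: "0 < \<delta>"
  \<comment> \<open>This choice gives \<open>D * d \<le> \<delta> / 3\<close> whatever the sign of
    \<open>D\<close>; the threshold for \<open>U n\<close> below makes the initial part less than
    another third.\<close>
  define d where "d = \<delta> / (3 * (\<bar>D\<bar> + 1))"
  have d: "0 < d" using \<delta> by (simp add: d_def)
  obtain m0 where m0: "\<And>m. m0 \<le> m \<Longrightarrow> \<bar>e m\<bar> \<le> d"
    using LIMSEQ_D[OF e d] by (auto intro: less_imp_le)
  define S where "S = (\<Sum>m=1..m0. r m * \<bar>e m\<bar>)"
  have S0: "0 \<le> S" unfolding S_def using r0 by (intro sum_nonneg) auto
  have "\<forall>\<^sub>F n in sequentially. norm ((\<Sum>m=1..n. r m * \<bar>e m\<bar>) / U n - 0) < \<delta>"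
    using D filterlim_at_top_dense[THEN iffD1, OF U, rule_format, of "max 0 (3 * S / \<delta>)"]
  proof eventually_elim
    case (elim n)
    have "(\<Sum>m=1..n. r m * \<bar>e m\<bar>) \<le> (\<Sum>m=1..n. (if m \<in> {1..m0} then r m * \<bar>e m\<bar> else 0) + r m * d)"
    proof (rule sum_mono)
      fix m assume "m \<in> {1..n}"
      then show "r m * \<bar>e m\<bar> \<le> (if m \<in> {1..m0} then r m * \<bar>e m\<bar> else 0) + r m * d"
        using m0[of m] r0[of m] d by (auto intro: mult_left_mono)
    qed
    also have "\<dots> = (\<Sum>m\<in>{1..n} \<inter> {1..m0}. r m * \<bar>e m\<bar>) + (\<Sum>m=1..n. r m) * d"
      unfolding sum.distrib sum_distrib_right
      by (simp only: sum.inter_restrict finite_atLeastAtMost)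
    also have "\<dots> \<le> S + D * U n * d"
      unfolding S_def using r0 elim d by (intro add_mono sum_mono2 mult_right_mono) auto
    also have "\<dots> < \<delta> * U n"
    proof -
      have "S < \<delta> / 3 * U n" using elim \<delta> by (simp add: field_simps)
      moreover have "D * d \<le> \<delta> / 3"
      proof -
        have "D * d \<le> (\<bar>D\<bar> + 1) * d" using d by (intro mult_right_mono) auto
        moreover have "(\<bar>D\<bar> + 1) * d = \<delta> / 3"
        proof -
          have "\<bar>D\<bar> + 1 \<noteq> 0" by linarith
          then show ?thesis unfolding d_def by (metis mult.commute nonzero_mult_divide_mult_cancel_left times_divide_eq_right)
        qed
        ultimately show ?thesis by simp
      qed
      then have "D * d * U n \<le> \<delta> / 3 * U n" using elim by (intro mult_right_mono) auto
      moreover have "0 < \<delta> * U n" using \<delta> elim by simp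
      ultimately show ?thesis by (simp add: mult_ac)
    qed
    finally have "(\<Sum>m=1..n. r m * \<bar>e m\<bar>) / U n < \<delta>" using elim by (simp add: field_simps)
    moreover have "0 \<le> (\<Sum>m=1..n. r m * \<bar>e m\<bar>) / U n"
      using elim r0 by (intro divide_nonneg_pos sum_nonneg) auto
    ultimately show ?case by simp
  qed
  then show "\<exists>no. \<forall>n\<ge>no. norm ((\<Sum>m=1..n. r m * \<bar>e m\<bar>) / U n - 0) < \<delta>"
    by (simp add: eventually_sequentially)
qed

lemma ex_real_power_interval:
  fixes \<alpha> x :: real
  assumes "1 < \<alpha>" "1 \<le> x"
  shows "\<exists>k. \<alpha> ^ k \<le> x \<and> x < \<alpha> ^ Suc k"
proof -
  obtain n where n: "x < \<alpha> ^ n" using real_arch_pow[OF assms(1)] by blast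
  define k where "k = (LEAST n. x < \<alpha> ^ n)"
  have k: "x < \<alpha> ^ k" unfolding k_def using n by (rule LeastI)
  then have "k \<noteq> 0" using assms(2) by (metis not_less power_0)
  then obtain j where j: "k = Suc j" by (cases k) auto
  then have "\<not> x < \<alpha> ^ j" using not_less_Least[of j "\<lambda>n. x < \<alpha> ^ n"] by (simp add: k_def)
  then show ?thesis using k j by (intro exI[of _ j]) auto
qed

lemma filterlim_floor_power_at_top:
  fixes \<alpha> :: real
  assumes \<alpha>: "1 < \<alpha>"
  shows "filterlim (\<lambda>k. \<alpha> ^ k) at_top sequentially"
    and "filterlim (\<lambda>k. nat \<lfloor>\<alpha> ^ k\<rfloor>) at_top sequentially"
proof -
  have "filterlim (\<lambda>k. \<alpha> ^ k) at_infinity sequentially"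
    using \<alpha> by (intro filterlim_realpow_sequentially_gt1) auto
  then show lim: "filterlim (\<lambda>k. \<alpha> ^ k) at_top sequentially"
    using \<alpha> by (intro filterlim_at_infinity_imp_filterlim_at_top) auto
  then show "filterlim (\<lambda>k. nat \<lfloor>\<alpha> ^ k\<rfloor>) at_top sequentially"
    by (intro filterlim_compose[OF filterlim_nat_sequentially] filterlim_compose[OF filterlim_floor_sequentially])
qed

text \<open>Between two points of the sequence the sum of \<open>z\<close> moves by at most the
  block sum of the majorant. The \<open>d\<close> part of that is a difference of two full sums,
  both negligible against \<open>U\<close> at the left end, so only the \<open>r\<close> part
  survives.\<close>

lemma geometric_block_interpolation:
  fixes z :: "nat \<Rightarrow> complex" and d r U :: "nat \<Rightarrow> real" and \<alpha> \<mu> \<delta> \<kappa> :: real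
  assumes \<alpha>: "1 < \<alpha>" and \<mu>: "0 \<le> \<mu>" and \<delta>: "0 < \<delta>"
    and zd: "\<And>m. cmod (z m) \<le> d m + 2 * \<mu> * r m"
    and U: "mono_on {1..} U" "filterlim U at_top sequentially"
    and z: "(\<lambda>k. cmod (\<Sum>m=1..nat \<lfloor>\<alpha> ^ k\<rfloor>. z m) / U (nat \<lfloor>\<alpha> ^ k\<rfloor>)) \<longlonglongrightarrow> 0"
    and d0: "(\<lambda>k. (\<Sum>m=1..nat \<lfloor>\<alpha> ^ k\<rfloor>. d m) / U (nat \<lfloor>\<alpha> ^ k\<rfloor>)) \<longlonglongrightarrow> 0"
    and d1: "(\<lambda>k. (\<Sum>m=1..nat \<lfloor>\<alpha> ^ Suc k\<rfloor>. d m) / U (nat \<lfloor>\<alpha> ^ k\<rfloor>)) \<longlonglongrightarrow> 0"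
    and r: "\<forall>\<^sub>F k in sequentially. (\<Sum>m\<in>{nat \<lfloor>\<alpha> ^ k\<rfloor><..nat \<lfloor>\<alpha> ^ Suc k\<rfloor>}. r m) \<le> \<kappa> * U (nat \<lfloor>\<alpha> ^ k\<rfloor>)"
    and \<kappa>: "0 \<le> \<kappa>"
  shows "\<forall>\<^sub>F n in sequentially. cmod (\<Sum>m=1..n. z m) \<le> (2 * \<mu> * \<kappa> + \<delta>) * U n"
proof -
  define a where "a k = nat \<lfloor>\<alpha> ^ k\<rfloor>" for k
  have a1: "1 \<le> a k" for k
  proof -
    have "1 \<le> \<alpha> ^ k" using \<alpha> by (simp add: one_le_power)
    then show ?thesis by (simp add: a_def le_nat_iff)
  qed
  have a_lim: "filterlim a at_top sequentially"
    unfolding a_def by (rule filterlim_floor_power_at_top[OF \<alpha>])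
  have "\<forall>\<^sub>F k in sequentially. 0 < U (a k)"
    using filterlim_compose[OF U(2) a_lim] by (simp add: filterlim_at_top_dense)
  moreover have "\<forall>\<^sub>F k in sequentially. cmod (\<Sum>m=1..a k. z m) / U (a k) < \<delta> / 3"
    using order_tendstoD(2)[OF z, of "\<delta> / 3"] \<delta> by (simp add: a_def)
  moreover have "\<forall>\<^sub>F k in sequentially. - (\<delta> / 3) < (\<Sum>m=1..a k. d m) / U (a k)"
    using order_tendstoD(1)[OF d0, of "- (\<delta> / 3)"] \<delta> by (simp add: a_def)
  moreover have "\<forall>\<^sub>F k in sequentially. (\<Sum>m=1..a (Suc k). d m) / U (a k) < \<delta> / 3"
    using order_tendstoD(2)[OF d1, of "\<delta> / 3"] \<delta> by (simp add: a_def)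
  ultimately have "\<forall>\<^sub>F k in sequentially. \<forall>n. a k \<le> n \<and> n \<le> a (Suc k) \<longrightarrow>
      cmod (\<Sum>m=1..n. z m) \<le> (2 * \<mu> * \<kappa> + \<delta>) * U n"
    using r[folded a_def]
  proof eventually_elim
    case (elim k)
    show ?case
    proof (intro allI impI)
      fix n assume n: "a k \<le> n \<and> n \<le> a (Suc k)"
      have split: "{1..j} = {1..a k} \<union> {a k<..j}" if "a k \<le> j" for j using that a1[of k] by auto
      have sum_split: "sum g {1..j} = sum g {1..a k} + sum g {a k<..j}" if "a k \<le> j"
        for j and g :: "nat \<Rightarrow> 'b::comm_monoid_add"
        unfolding split[OF that] by (rule sum.union_disjoint) auto
      \<comment> \<open>\<open>d\<close> alone may be negative; the nonnegativity of the whole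
        majorant is what permits enlarging the range from \<open>n\<close> to the end of the
        block.\<close>
      have pos: "0 \<le> d m + 2 * \<mu> * r m" for m using zd[of m] norm_ge_zero order_trans by blast
      have "cmod (\<Sum>m\<in>{a k<..n}. z m) \<le> (\<Sum>m\<in>{a k<..n}. d m + 2 * \<mu> * r m)"
        by (intro order_trans[OF norm_sum] sum_mono zd)
      also have "\<dots> \<le> (\<Sum>m\<in>{a k<..a (Suc k)}. d m + 2 * \<mu> * r m)"
        by (intro sum_mono2) (use n pos in auto)
      also have "\<dots> = (\<Sum>m\<in>{a k<..a (Suc k)}. d m) + 2 * \<mu> * (\<Sum>m\<in>{a k<..a (Suc k)}. r m)"
        by (simp add: sum.distrib sum_distrib_left)
      also have "(\<Sum>m\<in>{a k<..a (Suc k)}. d m) = (\<Sum>m=1..a (Suc k). d m) - (\<Sum>m=1..a k. d m)"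
        using sum_split[of "a (Suc k)" d] n by simp
      also have "2 * \<mu> * (\<Sum>m\<in>{a k<..a (Suc k)}. r m) \<le> 2 * \<mu> * (\<kappa> * U (a k))"
        using elim \<mu> by (intro mult_left_mono) auto
      finally have "cmod (\<Sum>m\<in>{a k<..n}. z m)
          \<le> (\<Sum>m=1..a (Suc k). d m) - (\<Sum>m=1..a k. d m) + 2 * \<mu> * (\<kappa> * U (a k))" by simp
      moreover have "cmod (\<Sum>m=1..n. z m) \<le> cmod (\<Sum>m=1..a k. z m) + cmod (\<Sum>m\<in>{a k<..n}. z m)"
        using sum_split[of n z] n norm_triangle_ineq by auto
      moreover have "cmod (\<Sum>m=1..a k. z m) < \<delta> / 3 * U (a k)" "- (\<delta> / 3) * U (a k) < (\<Sum>m=1..a k. d m)"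
        "(\<Sum>m=1..a (Suc k). d m) < \<delta> / 3 * U (a k)"
        using elim(2-4) by (simp_all only: pos_divide_less_eq[OF elim(1)] pos_less_divide_eq[OF elim(1)])
      ultimately have "cmod (\<Sum>m=1..n. z m) \<le> (2 * \<mu> * \<kappa> + \<delta>) * U (a k)"
        by (simp add: algebra_simps)
      also have "U (a k) \<le> U n" using U(1) n a1[of k] by (auto simp: mono_on_def)
      then have "(2 * \<mu> * \<kappa> + \<delta>) * U (a k) \<le> (2 * \<mu> * \<kappa> + \<delta>) * U n"
        using \<mu> \<kappa> \<delta> by (intro mult_left_mono) auto
      finally show "cmod (\<Sum>m=1..n. z m) \<le> (2 * \<mu> * \<kappa> + \<delta>) * U n" .
    qed
  qed
  then obtain k0 where k0: "\<And>k n. k0 \<le> k \<Longrightarrow> a k \<le> n \<Longrightarrow> n \<le> a (Suc k) \<Longrightarrow>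
      cmod (\<Sum>m=1..n. z m) \<le> (2 * \<mu> * \<kappa> + \<delta>) * U n"
    unfolding eventually_sequentially by blast
  show ?thesis
    unfolding eventually_sequentially
  proof (intro exI allI impI)
    fix n assume n: "nat \<lceil>\<alpha> ^ k0\<rceil> \<le> n"
    then have n': "\<alpha> ^ k0 \<le> real n" by linarith
    moreover have "1 \<le> \<alpha> ^ k0" using \<alpha> by (simp add: one_le_power)
    ultimately obtain k where k: "\<alpha> ^ k \<le> real n" "real n < \<alpha> ^ Suc k"
      using ex_real_power_interval[OF \<alpha>, of "real n"] by auto
    \<comment> \<open>The threshold for \<open>n\<close> forces the index of the block that contains
      \<open>n\<close> to be at least \<open>k0\<close>.\<close>
    have "\<alpha> ^ k0 < \<alpha> ^ Suc k" using n' k by linarith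
    then have "k0 \<le> k" using \<alpha> by (metis less_Suc_eq_le power_strict_increasing_iff)
    moreover have "a k \<le> n" using k unfolding a_def by linarith
    moreover have "n \<le> a (Suc k)" using k unfolding a_def by (simp add: le_nat_floor)
    ultimately show "cmod (\<Sum>m=1..n. z m) \<le> (2 * \<mu> * \<kappa> + \<delta>) * U n" by (rule k0)
  qed
qed

lemma (in prob_space) identically_distributed_expectation:
  fixes X Y :: "'a \<Rightarrow> real" and g :: "real \<Rightarrow> real"
  assumes [measurable]: "X \<in> borel_measurable M" "Y \<in> borel_measurable M" "g \<in> borel_measurable borel"
    and d: "distr M borel Y = distr M borel X"
  shows "expectation (\<lambda>\<omega>. g (Y \<omega>)) = expectation (\<lambda>\<omega>. g (X \<omega>))"
proof -
  have "expectation (\<lambda>\<omega>. g (Y \<omega>)) = integral\<^sup>L (distr M borel Y) g"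
    by (subst integral_distr) auto
  also have "\<dots> = expectation (\<lambda>\<omega>. g (X \<omega>))"
    unfolding d by (subst integral_distr) auto
  finally show ?thesis .
qed

text \<open>The first estimate makes the left end of a block an admissible argument of
  \<open>U\<close> for sums of squares up to the right end. The second bounds the proportion of
  integers in the block, the source of smallness as \<open>\<alpha>\<close> tends to 1.\<close>

lemma geometric_floor_blocks:
  fixes \<alpha> :: real
  assumes \<alpha>: "1 < \<alpha>" "\<alpha> \<le> 5 / 4"
  shows "\<forall>\<^sub>F k in sequentially. 3 / 4 * real (nat \<lfloor>\<alpha> ^ Suc k\<rfloor>) \<le> real (nat \<lfloor>\<alpha> ^ k\<rfloor>)"
    and "\<forall>\<^sub>F k in sequentially.
      real (nat \<lfloor>\<alpha> ^ Suc k\<rfloor>) - real (nat \<lfloor>\<alpha> ^ k\<rfloor>) \<le> (\<alpha> - 1) * real (nat \<lfloor>\<alpha> ^ Suc k\<rfloor>)"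
proof -
  have fl: "real (nat \<lfloor>\<alpha> ^ k\<rfloor>) \<le> \<alpha> ^ k" "\<alpha> ^ k - 1 \<le> real (nat \<lfloor>\<alpha> ^ k\<rfloor>)" for k
  proof -
    have "0 \<le> \<alpha> ^ k" using \<alpha> by simp
    then show "real (nat \<lfloor>\<alpha> ^ k\<rfloor>) \<le> \<alpha> ^ k" "\<alpha> ^ k - 1 \<le> real (nat \<lfloor>\<alpha> ^ k\<rfloor>)" by linarith+
  qed
  have ev: "\<forall>\<^sub>F k in sequentially. c \<le> \<alpha> ^ k" for c
    using filterlim_floor_power_at_top(1)[OF \<alpha>(1)] by (simp add: filterlim_at_top)
  \<comment> \<open>Since 3/4 times 5/4 is 15/16, rounding is absorbed once a sixteenth of
    \<open>\<alpha> ^ k\<close> is at least 1.\<close>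
  show "\<forall>\<^sub>F k in sequentially. 3 / 4 * real (nat \<lfloor>\<alpha> ^ Suc k\<rfloor>) \<le> real (nat \<lfloor>\<alpha> ^ k\<rfloor>)"
    using ev[of 16]
  proof eventually_elim
    case (elim k)
    have "\<alpha> ^ Suc k \<le> 5 / 4 * \<alpha> ^ k" using \<alpha> by simp
    then show ?case using fl(1)[of "Suc k"] fl(2)[of k] elim by linarith
  qed
  \<comment> \<open>Without rounding the proportion would be
    \<open>(\<alpha> - 1) / \<alpha>\<close>. The slack up to \<open>\<alpha> - 1\<close> covers the
    rounding exactly from the threshold below on.\<close>
  show "\<forall>\<^sub>F k in sequentially.
      real (nat \<lfloor>\<alpha> ^ Suc k\<rfloor>) - real (nat \<lfloor>\<alpha> ^ k\<rfloor>) \<le> (\<alpha> - 1) * real (nat \<lfloor>\<alpha> ^ Suc k\<rfloor>)"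
    using ev[of "\<alpha> / (\<alpha> - 1)\<^sup>2"]
  proof eventually_elim
    case (elim k)
    then have "\<alpha> \<le> \<alpha> ^ k * (\<alpha> - 1)\<^sup>2" using \<alpha> by (simp add: pos_divide_le_eq)
    then have "\<alpha> * \<alpha> ^ k - (\<alpha> ^ k - 1) \<le> (\<alpha> - 1) * (\<alpha> * \<alpha> ^ k - 1)"
      by (simp add: power2_eq_square algebra_simps)
    moreover have "(\<alpha> - 1) * (\<alpha> ^ Suc k - 1) \<le> (\<alpha> - 1) * real (nat \<lfloor>\<alpha> ^ Suc k\<rfloor>)"
      using \<alpha> fl by (intro mult_left_mono) auto
    ultimately show ?case using fl(1)[of "Suc k"] fl(2)[of k] by simp
  qed
qed

text \<open>Cauchy-Schwarz against the constant 1: the number of terms is at most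
  \<open>t * b\<close>, which cancels the denominator \<open>b\<close> and leaves the factor
  \<open>sqrt t\<close>.\<close>

lemma sum_norm_block_le:
  fixes f :: "nat \<Rightarrow> complex"
  assumes sq: "(\<Sum>m=1..b. (cmod (f m))\<^sup>2) \<le> C * u\<^sup>2 / real b" and ab: "a \<le> b" "0 < b"
    and nonneg: "0 \<le> u" "0 \<le> C" "0 \<le> t" and len: "real b - real a \<le> t * real b"
  shows "(\<Sum>m\<in>{a<..b}. cmod (f m)) \<le> sqrt (C * t) * u"
proof (rule power2_le_imp_le)
  have "(\<Sum>m\<in>{a<..b}. cmod (f m) * 1)\<^sup>2 \<le> (\<Sum>m\<in>{a<..b}. (cmod (f m))\<^sup>2) * (\<Sum>m\<in>{a<..b}. 1\<^sup>2)"
    by (rule Cauchy_Schwarz_ineq_sum)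
  also have "\<dots> \<le> (C * u\<^sup>2 / real b) * (t * real b)"
  proof (rule mult_mono)
    have "(\<Sum>m\<in>{a<..b}. (cmod (f m))\<^sup>2) \<le> (\<Sum>m=1..b. (cmod (f m))\<^sup>2)"
      by (rule sum_mono2) auto
    then show "(\<Sum>m\<in>{a<..b}. (cmod (f m))\<^sup>2) \<le> C * u\<^sup>2 / real b" using sq by linarith
    show "(\<Sum>m\<in>{a<..b}. 1\<^sup>2) \<le> t * real b" using len ab by (simp add: of_nat_diff)
    show "0 \<le> C * u\<^sup>2 / real b" using nonneg by simp
    show "0 \<le> (\<Sum>m\<in>{a<..b}. 1\<^sup>2 :: real)" by simp
  qed
  also have "\<dots> = C * t * u\<^sup>2" using ab by simp
  also have "\<dots> = (sqrt (C * t) * u)\<^sup>2"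
    unfolding power_mult_distrib using nonneg by (subst real_sqrt_pow2) auto
  finally show "(\<Sum>m\<in>{a<..b}. cmod (f m))\<^sup>2 \<le> (sqrt (C * t) * u)\<^sup>2" by simp
  show "0 \<le> sqrt (C * t) * u" using nonneg by simp
qed

section \<open>The strong law with normalization by \<open>U\<close>\<close>

lemma (in prob_space) weighted_slln:
  fixes f :: "nat \<Rightarrow> complex" and U :: "nat \<Rightarrow> real" and X :: "'a \<Rightarrow> real" and Xs :: "nat \<Rightarrow> 'a \<Rightarrow> real"
  assumes U: "\<And>n. 1 \<le> n \<Longrightarrow> 0 \<le> U n" "mono_on {1..} U" "filterlim U at_top sequentially"
    and C: "0 < C" "\<forall>\<^sub>F N in sequentially. \<forall>n\<ge>1. 3 / 4 * real N \<le> real n \<longrightarrow>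
        (\<Sum>m=1..N. (cmod (f m))\<^sup>2) \<le> C * (U n)\<^sup>2 / real N"
    and indep: "indep_vars (\<lambda>_. borel) Xs {1..}"
    and X [measurable]: "X \<in> borel_measurable M"
    and distr: "\<And>m. 1 \<le> m \<Longrightarrow> distr M borel (Xs m) = distr M borel X"
    and int: "integrable M X"
  shows "AE \<omega> in M. (\<lambda>n. cmod (\<Sum>m=1..n. f m * complex_of_real (Xs m \<omega> - expectation X)) / U n) \<longlonglongrightarrow> 0"
proof -
  define Y where "Y m \<omega> = truncate m (Xs m \<omega>)" for m \<omega>
  define v where "v n = expectation (\<lambda>\<omega>. (truncate n (X \<omega>))\<^sup>2)" for n
  define \<mu> where "\<mu> = expectation (\<lambda>\<omega>. \<bar>X \<omega>\<bar>)"
  define EY where "EY m = expectation (Y m)" for m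
  define EA where "EA m = expectation (\<lambda>\<omega>. \<bar>Y m \<omega>\<bar>)" for m
  have \<mu>0: "0 \<le> \<mu>" by (simp add: \<mu>_def)
  have meas: "Xs i \<in> borel_measurable M" if "1 \<le> i" for i
    using indep that unfolding indep_vars_def by auto
  \<comment> \<open>Index 0 lies outside the hypotheses on \<open>Xs\<close>; truncation at level 0
    makes the bound on \<open>EA\<close> hold there as well.\<close>
  have Y0: "Y 0 \<omega> = 0" for \<omega> by (simp add: Y_def truncate_def)
  have transfer: "expectation (\<lambda>\<omega>. g (Xs m \<omega>)) = expectation (\<lambda>\<omega>. g (X \<omega>))"
    if "1 \<le> m" "g \<in> borel_measurable borel" for m and g :: "real \<Rightarrow> real"
    using that by (intro identically_distributed_expectation meas X distr)
  have trunc2_int: "integrable M (\<lambda>\<omega>. (truncate n (X \<omega>))\<^sup>2)" for n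
  proof (rule integrable_const_bound[where B = "(real n)\<^sup>2"])
    show "AE x in M. norm ((truncate n (X x))\<^sup>2) \<le> (real n)\<^sup>2"
      using abs_truncate_le(1)[of n] by (intro AE_I2) (simp add: abs_le_square_iff[symmetric])
  qed measurable
  have v: "expectation (\<lambda>\<omega>. (Y m \<omega>)\<^sup>2) \<le> v n" if "1 \<le> m" "m \<le> n" for m n
  proof -
    have "expectation (\<lambda>\<omega>. (Y m \<omega>)\<^sup>2) = expectation (\<lambda>\<omega>. (truncate m (X \<omega>))\<^sup>2)"
      unfolding Y_def by (rule transfer[OF that(1)]) measurable
    also have "\<dots> \<le> v n"
      unfolding v_def by (intro integral_mono trunc2_int truncate_square_mono that)
    finally show ?thesis .
  qed
  have v0: "0 \<le> v n" for n by (simp add: v_def)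
  have EA: "EA m \<le> \<mu>" for m
  proof (cases "m = 0")
    case True
    then show ?thesis using \<mu>0 by (simp add: EA_def Y0)
  next
    case False
    then have "EA m = expectation (\<lambda>\<omega>. \<bar>truncate m (X \<omega>)\<bar>)"
      unfolding EA_def Y_def by (intro transfer) auto
    also have "\<dots> \<le> \<mu>"
      unfolding \<mu>_def using int abs_truncate_le(2)
      by (intro integral_mono integrable_abs Bochner_Integration.integrable_bound[OF int]) auto
    finally show ?thesis .
  qed
  have indepY: "indep_vars (\<lambda>_. borel) Y {1..}"
    unfolding Y_def by (rule indep_vars_compose2[OF indep]) auto
  have indepA: "indep_vars (\<lambda>_. borel) (\<lambda>m \<omega>. \<bar>Y m \<omega>\<bar>) {1..}"
    by (rule indep_vars_compose2[OF indepY]) auto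
  have Yb: "\<bar>Y m \<omega>\<bar> \<le> real m" for m \<omega> by (simp add: Y_def abs_truncate_le)

  \<comment> \<open>The exceptional null set may depend on \<open>\<alpha>\<close> but not on
    \<open>\<delta>\<close>, so later only \<open>\<alpha>\<close> has to be restricted to countably
    many values.\<close>
  have block: "AE \<omega> in M. \<forall>\<delta>>0. \<forall>\<^sub>F n in sequentially.
      cmod (\<Sum>m=1..n. f m * complex_of_real (Y m \<omega> - EY m)) \<le> (2 * \<mu> * sqrt (C * (\<alpha> - 1)) + \<delta>) * U n"
    if \<alpha>: "1 < \<alpha>" "\<alpha> \<le> 5 / 4" for \<alpha> :: real
  proof -
    define a where "a k = nat \<lfloor>\<alpha> ^ k\<rfloor>" for k
    have a_lim: "filterlim a at_top sequentially"
      unfolding a_def by (rule filterlim_floor_power_at_top[OF \<alpha>(1)])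
    have a1: "1 \<le> a k" for k
    proof -
      have "1 \<le> \<alpha> ^ k" using \<alpha> by (simp add: one_le_power)
      then show ?thesis by (simp add: a_def le_nat_iff)
    qed
    have a_mono: "a k \<le> a (Suc k)" for k
      unfolding a_def using \<alpha> by (intro nat_mono floor_mono power_increasing) auto
    have asuc_lim: "filterlim (\<lambda>k. a (Suc k)) at_top sequentially"
      using a_lim by (simp add: filterlim_sequentially_Suc)
    have w0: "\<forall>\<^sub>F k in sequentially. (\<Sum>m=1..a k. (cmod (f m))\<^sup>2) \<le> C * (U (a k))\<^sup>2 / real (a k)"
      using eventually_compose_filterlim[OF C(2) a_lim]
    proof eventually_elim
      case (elim k)
      show ?case by (rule elim[rule_format, OF a1]) simp
    qed
    \<comment> \<open>Squares up to the right end are measured by \<open>U\<close> at the left end;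
      the factor \<open>3 / 4\<close> and the bound \<open>5 / 4\<close> on \<open>\<alpha>\<close>
      are matched for this.\<close>
    have w1: "\<forall>\<^sub>F k in sequentially. (\<Sum>m=1..a (Suc k). (cmod (f m))\<^sup>2) \<le> C * (U (a k))\<^sup>2 / real (a (Suc k))"
      using eventually_compose_filterlim[OF C(2) asuc_lim] geometric_floor_blocks(1)[OF \<alpha>, folded a_def]
    proof eventually_elim
      case (elim k)
      show ?case by (rule elim(1)[rule_format, OF a1 elim(2)])
    qed
    have summ: "summable (\<lambda>k. v (a k) / real (a k))"
    proof (rule summableI_nonneg_bounded)
      fix K
      have "(\<Sum>k<K. v (a k) / real (a k)) = expectation (\<lambda>\<omega>. \<Sum>k<K. (truncate (a k) (X \<omega>))\<^sup>2 / real (a k))"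
        unfolding v_def using trunc2_int by (simp add: Bochner_Integration.integral_sum)
      also have "\<dots> \<le> expectation (\<lambda>\<omega>. 2 * \<alpha> / (\<alpha> - 1) * \<bar>X \<omega>\<bar>)"
      proof (rule integral_mono)
        show "integrable M (\<lambda>\<omega>. \<Sum>k<K. (truncate (a k) (X \<omega>))\<^sup>2 / real (a k))"
          by (intro Bochner_Integration.integrable_sum integrable_divide trunc2_int)
        show "integrable M (\<lambda>\<omega>. 2 * \<alpha> / (\<alpha> - 1) * \<bar>X \<omega>\<bar>)"
          by (intro integrable_mult_right integrable_abs int)
        show "(\<Sum>k<K. (truncate (a k) (X \<omega>))\<^sup>2 / real (a k)) \<le> 2 * \<alpha> / (\<alpha> - 1) * \<bar>X \<omega>\<bar>" for \<omega>
          unfolding a_def by (rule sum_truncate_geometric_le[OF \<alpha>(1)])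
      qed
      finally show "(\<Sum>k<K. v (a k) / real (a k)) \<le> expectation (\<lambda>\<omega>. 2 * \<alpha> / (\<alpha> - 1) * \<bar>X \<omega>\<bar>)" .
    qed (simp add: v0)
    then have summ1: "summable (\<lambda>k. v (a (Suc k)) / real (a (Suc k)))"
      by (subst summable_Suc_iff)
    \<comment> \<open>The fluctuation lemma takes real weights, so the real and imaginary parts of
      \<open>f\<close> are treated separately.\<close>
    have dom: "\<forall>\<^sub>F k in sequentially. (\<Sum>m=1..N k. (w m)\<^sup>2) \<le> C * (u k)\<^sup>2 / real (N k)"
      if "\<forall>\<^sub>F k in sequentially. (\<Sum>m=1..N k. (cmod (f m))\<^sup>2) \<le> C * (u k)\<^sup>2 / real (N k)"
        "\<And>m. \<bar>w m\<bar> \<le> cmod (f m)" for N :: "nat \<Rightarrow> nat" and u w :: "nat \<Rightarrow> real"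
      using that(1)
    proof eventually_elim
      case (elim k)
      have "(\<Sum>m=1..N k. (w m)\<^sup>2) \<le> (\<Sum>m=1..N k. (cmod (f m))\<^sup>2)"
        using that(2) by (intro sum_mono) (simp add: abs_le_square_iff[symmetric])
      then show ?case using elim by linarith
    qed
    have re: "AE \<omega> in M. (\<lambda>k. (\<Sum>m=1..a k. Re (f m) * (Y m \<omega> - EY m)) / U (a k)) \<longlonglongrightarrow> 0"
      unfolding EY_def
      by (rule AE_subsequence_fluctuation[OF indepY Yb v dom[OF w0 abs_Re_le_cmod] summ v0])
    have im: "AE \<omega> in M. (\<lambda>k. (\<Sum>m=1..a k. Im (f m) * (Y m \<omega> - EY m)) / U (a k)) \<longlonglongrightarrow> 0"
      unfolding EY_def
      by (rule AE_subsequence_fluctuation[OF indepY Yb v dom[OF w0 abs_Im_le_cmod] summ v0])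
    \<comment> \<open>The absolute values, weighted by \<open>cmod (f m)\<close>, control the
      movement inside a block; the same is needed at both of its ends.\<close>
    have d0: "AE \<omega> in M. (\<lambda>k. (\<Sum>m=1..a k. cmod (f m) * (\<bar>Y m \<omega>\<bar> - EA m)) / U (a k)) \<longlonglongrightarrow> 0"
      unfolding EA_def
      by (rule AE_subsequence_fluctuation[where b = real, OF indepA _ _ w0 summ v0]) (simp_all only: abs_idempotent power2_abs Yb v)
    have d1: "AE \<omega> in M. (\<lambda>k. (\<Sum>m=1..a (Suc k). cmod (f m) * (\<bar>Y m \<omega>\<bar> - EA m)) / U (a k)) \<longlonglongrightarrow> 0"
      unfolding EA_def
      by (rule AE_subsequence_fluctuation[where b = real, OF indepA _ _ w1 summ1 v0]) (simp_all only: abs_idempotent power2_abs Yb v)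
    \<comment> \<open>This is the one contribution that does not vanish for fixed
      \<open>\<alpha>\<close>.\<close>
    have r: "\<forall>\<^sub>F k in sequentially. (\<Sum>m\<in>{a k<..a (Suc k)}. cmod (f m)) \<le> sqrt (C * (\<alpha> - 1)) * U (a k)"
      using w1 geometric_floor_blocks(2)[OF \<alpha>, folded a_def]
    proof eventually_elim
      case (elim k)
      show ?case
        by (rule sum_norm_block_le[OF elim(1) a_mono _ _ _ _ elim(2)])
          (use a1[of "Suc k"] U(1)[OF a1[of k]] C(1) \<alpha> in linarith)+
    qed
    from re im d0 d1 show ?thesis
    proof eventually_elim
      case (elim \<omega>)
      define z where "z m = f m * complex_of_real (Y m \<omega> - EY m)" for m
      define d where "d m = cmod (f m) * (\<bar>Y m \<omega>\<bar> - EA m)" for m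
      \<comment> \<open>One \<open>\<mu>\<close> bounds the mean \<open>EY m\<close>, the other pays
        for centring \<open>\<bar>Y m \<omega>\<bar>\<close> at \<open>EA m\<close>.\<close>
      have zd: "cmod (z m) \<le> d m + 2 * \<mu> * cmod (f m)" for m
      proof -
        have "\<bar>EY m\<bar> \<le> EA m" unfolding EY_def EA_def by (rule integral_abs_bound)
        then have "\<bar>Y m \<omega> - EY m\<bar> \<le> (\<bar>Y m \<omega>\<bar> - EA m) + 2 * \<mu>" using EA[of m] by linarith
        then have "cmod (f m) * \<bar>Y m \<omega> - EY m\<bar> \<le> cmod (f m) * ((\<bar>Y m \<omega>\<bar> - EA m) + 2 * \<mu>)"
          by (rule mult_left_mono) simp
        then show ?thesis
          unfolding z_def d_def norm_mult norm_of_real by (simp only: distrib_left mult.commute)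
      qed
      have lim_re_im: "(\<lambda>k. \<bar>(\<Sum>m=1..a k. Re (f m) * (Y m \<omega> - EY m)) / U (a k)\<bar>
          + \<bar>(\<Sum>m=1..a k. Im (f m) * (Y m \<omega> - EY m)) / U (a k)\<bar>) \<longlonglongrightarrow> 0"
        by (rule tendsto_add_zero[OF tendsto_rabs_zero[OF elim(1)] tendsto_rabs_zero[OF elim(2)]])
      have cmp: "norm (cmod (\<Sum>m=1..a k. z m) / U (a k))
          \<le> \<bar>(\<Sum>m=1..a k. Re (f m) * (Y m \<omega> - EY m)) / U (a k)\<bar>
          + \<bar>(\<Sum>m=1..a k. Im (f m) * (Y m \<omega> - EY m)) / U (a k)\<bar>" for k
      proof -
        have re_im: "Re (\<Sum>m=1..a k. z m) = (\<Sum>m=1..a k. Re (f m) * (Y m \<omega> - EY m))"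
          "Im (\<Sum>m=1..a k. z m) = (\<Sum>m=1..a k. Im (f m) * (Y m \<omega> - EY m))"
          unfolding Re_sum Im_sum z_def by simp_all
        have "cmod (\<Sum>m=1..a k. z m) / \<bar>U (a k)\<bar>
            \<le> (\<bar>Re (\<Sum>m=1..a k. z m)\<bar> + \<bar>Im (\<Sum>m=1..a k. z m)\<bar>) / \<bar>U (a k)\<bar>"
          by (intro divide_right_mono cmod_le) simp
        then show ?thesis
          unfolding re_im real_norm_def abs_divide add_divide_distrib by simp
      qed
      have z: "(\<lambda>k. cmod (\<Sum>m=1..a k. z m) / U (a k)) \<longlonglongrightarrow> 0"
        by (rule Lim_null_comparison[OF always_eventually[OF allI[OF cmp]] lim_re_im])
      show ?case
      proof (intro allI impI)
        fix \<delta> :: real assume "0 < \<delta>"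
        show "\<forall>\<^sub>F n in sequentially. cmod (\<Sum>m=1..n. f m * complex_of_real (Y m \<omega> - EY m))
            \<le> (2 * \<mu> * sqrt (C * (\<alpha> - 1)) + \<delta>) * U n"
          unfolding z_def[symmetric]
          by (rule geometric_block_interpolation[OF \<alpha>(1) \<mu>0 \<open>0 < \<delta>\<close> zd U(2,3), folded a_def,
                OF z elim(3,4)[folded d_def] r])
            (use C(1) \<alpha>(1) in simp)
      qed
    qed
  qed

  have centered: "AE \<omega> in M. (\<lambda>n. cmod (\<Sum>m=1..n. f m * complex_of_real (Y m \<omega> - EY m)) / U n) \<longlonglongrightarrow> 0"
  proof -
    \<comment> \<open>A countable choice of ratios within \<open>5 / 4\<close> and tending to 1, so
      that the exceptional sets have a null union.\<close>
    define \<alpha> where "\<alpha> j = 1 + 1 / real (j + 4)" for j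
    have "1 < \<alpha> j \<and> \<alpha> j \<le> 5 / 4" for j by (simp add: \<alpha>_def field_simps)
    then have "AE \<omega> in M. \<forall>j. \<forall>\<delta>>0. \<forall>\<^sub>F n in sequentially.
      cmod (\<Sum>m=1..n. f m * complex_of_real (Y m \<omega> - EY m)) \<le> (2 * \<mu> * sqrt (C * (\<alpha> j - 1)) + \<delta>) * U n"
      unfolding AE_all_countable using block by blast
    then show ?thesis
    proof eventually_elim
      case (elim \<omega>)
      show ?case
      proof (rule tendstoI)
        fix \<epsilon> :: real assume \<epsilon>: "0 < \<epsilon>"
        have "(\<lambda>j. 2 * \<mu> * sqrt (C * (1 / real (j + 4)))) \<longlonglongrightarrow> 2 * \<mu> * sqrt (C * 0)"
          by (intro tendsto_intros LIMSEQ_ignore_initial_segment[OF lim_1_over_n])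
        then have "\<forall>\<^sub>F j in sequentially. 2 * \<mu> * sqrt (C * (\<alpha> j - 1)) < \<epsilon> / 3"
          using \<epsilon> by (intro order_tendstoD(2)) (auto simp: \<alpha>_def)
        then obtain j where j: "2 * \<mu> * sqrt (C * (\<alpha> j - 1)) < \<epsilon> / 3"
          unfolding eventually_sequentially by blast
        have "\<forall>\<^sub>F n in sequentially. cmod (\<Sum>m=1..n. f m * complex_of_real (Y m \<omega> - EY m))
            \<le> (2 * \<mu> * sqrt (C * (\<alpha> j - 1)) + \<epsilon> / 3) * U n"
          using elim \<epsilon> by simp
        moreover have "\<forall>\<^sub>F n in sequentially. 0 < U n"
          using U(3) by (simp add: filterlim_at_top_dense)
        ultimately show "\<forall>\<^sub>F n in sequentially.
            dist (cmod (\<Sum>m=1..n. f m * complex_of_real (Y m \<omega> - EY m)) / U n) 0 < \<epsilon>"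
        proof eventually_elim
          case (elim n)
          have "(2 * \<mu> * sqrt (C * (\<alpha> j - 1)) + \<epsilon> / 3) * U n < \<epsilon> * U n"
            using j \<epsilon> elim(2) by (intro mult_strict_right_mono) auto
          then have "cmod (\<Sum>m=1..n. f m * complex_of_real (Y m \<omega> - EY m)) < \<epsilon> * U n"
            using elim(1) by linarith
          then show ?case using elim(2) by (simp add: pos_divide_less_eq)
        qed
      qed
    qed
  qed

  have mean: "EY \<longlonglongrightarrow> expectation X"
  proof -
    have "(\<lambda>m. expectation (\<lambda>\<omega>. truncate m (X \<omega>))) \<longlonglongrightarrow> expectation X"
    proof (rule integral_dominated_convergence[where w = "\<lambda>\<omega>. \<bar>X \<omega>\<bar>"])
      show "AE \<omega> in M. (\<lambda>m. truncate m (X \<omega>)) \<longlonglongrightarrow> X \<omega>"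
      proof (rule AE_I2)
        fix \<omega>
        have "\<forall>\<^sub>F m in sequentially. truncate m (X \<omega>) = X \<omega>"
          using eventually_ge_at_top[of "nat \<lceil>\<bar>X \<omega>\<bar>\<rceil>"]
          by eventually_elim (auto simp: truncate_def nat_le_iff ceiling_le_iff)
        then show "(\<lambda>m. truncate m (X \<omega>)) \<longlonglongrightarrow> X \<omega>" by (rule tendsto_eventually)
      qed
    qed (use int abs_truncate_le(2) in auto)
    moreover have "\<forall>\<^sub>F m in sequentially. expectation (\<lambda>\<omega>. truncate m (X \<omega>)) = EY m"
      using eventually_ge_at_top[of 1]
    proof eventually_elim
      case (elim m)
      show ?case unfolding EY_def Y_def by (rule transfer[OF elim, symmetric]) measurable
    qed
    ultimately show ?thesis by (rule Lim_transform_eventually)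
  qed

  have trunc_ev: "AE \<omega> in M. \<forall>\<^sub>F m in sequentially. Xs m \<omega> = Y m \<omega>"
  proof -
    \<comment> \<open>The shift by one avoids index 0, where nothing is known about the
      distribution. By Borel-Cantelli almost surely only finitely many of these events
      occur.\<close>
    define A where "A m = {\<omega> \<in> space M. real (Suc m) < \<bar>Xs (Suc m) \<omega>\<bar>}" for m
    have A_meas [measurable]: "A m \<in> sets M" for m
      unfolding A_def using meas[of "Suc m"] by measurable
    define q where "q m x = (if real (Suc m) < \<bar>x\<bar> then 1 else 0 :: real)" for m and x :: real
    have q_meas [measurable]: "q m \<in> borel_measurable borel" for m unfolding q_def by measurable
    have q_int: "integrable M (\<lambda>\<omega>. q m (X \<omega>))" for m
      by (rule integrable_const_bound[where B = 1]) (auto simp: q_def)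
    have PA: "prob (A m) = expectation (\<lambda>\<omega>. q m (X \<omega>))" for m
    proof -
      have "prob (A m) = expectation (indicator (A m))" by simp
      also have "\<dots> = expectation (\<lambda>\<omega>. q m (Xs (Suc m) \<omega>))"
        by (intro Bochner_Integration.integral_cong) (auto simp: A_def q_def indicator_def)
      also have "\<dots> = expectation (\<lambda>\<omega>. q m (X \<omega>))" by (rule transfer) auto
      finally show ?thesis .
    qed
    have "summable (\<lambda>m. prob (A m))"
    proof (rule summableI_nonneg_bounded)
      fix K
      have "(\<Sum>m<K. prob (A m)) = expectation (\<lambda>\<omega>. \<Sum>m<K. q m (X \<omega>))"
        unfolding PA using q_int by (simp add: Bochner_Integration.integral_sum)
      also have "\<dots> \<le> \<mu>"
        unfolding \<mu>_def
      proof (intro integral_mono Bochner_Integration.integrable_sum q_int integrable_abs int)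
        fix \<omega>
        show "(\<Sum>m<K. q m (X \<omega>)) \<le> \<bar>X \<omega>\<bar>"
          using sum_indicator_less_le[of "\<bar>X \<omega>\<bar>" K] by (simp add: q_def)
      qed
      finally show "(\<Sum>m<K. prob (A m)) \<le> \<mu>" .
    qed simp
    then have "AE \<omega> in M. \<forall>\<^sub>F m in sequentially. \<omega> \<in> space M - A m"
      by (intro borel_cantelli_AE1) (auto simp: emeasure_eq_measure)
    then show ?thesis
    proof eventually_elim
      case (elim \<omega>)
      then have "\<forall>\<^sub>F m in sequentially. Xs (Suc m) \<omega> = Y (Suc m) \<omega>"
        by eventually_elim (auto simp: A_def Y_def truncate_def)
      then show ?case by (simp only: eventually_sequentially_Suc[of "\<lambda>m. Xs m \<omega> = Y m \<omega>"])
    qed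
  qed

  \<comment> \<open>The block bound with left end 0 and \<open>t = 1\<close>; it supplies the total
    weight for the Toeplitz argument.\<close>
  have l1: "\<forall>\<^sub>F n in sequentially. (\<Sum>m=1..n. cmod (f m)) \<le> sqrt (C * 1) * U n"
    using C(2) eventually_ge_at_top[of 1]
  proof eventually_elim
    case (elim n)
    have "(\<Sum>m\<in>{0<..n}. cmod (f m)) \<le> sqrt (C * 1) * U n"
      using elim U(1) C(1) by (intro sum_norm_block_le) auto
    moreover have "{0<..n} = {1..n}" by auto
    ultimately show ?case by simp
  qed

  from centered trunc_ev show ?thesis
  proof eventually_elim
    case (elim \<omega>)
    \<comment> \<open>\<open>e\<close> collects the truncation error and the shift of the mean. It
      tends to 0 for the fixed \<open>\<omega>\<close>, so its weighted sum is negligible against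
      \<open>U\<close>.\<close>
    define e where "e m = (Xs m \<omega> - Y m \<omega>) + (EY m - expectation X)" for m
    have "(\<lambda>m. Xs m \<omega> - Y m \<omega>) \<longlonglongrightarrow> 0"
      using elim(2) by (intro tendsto_eventually) (auto elim!: eventually_mono)
    moreover have "(\<lambda>m. EY m - expectation X) \<longlonglongrightarrow> 0" using mean by (simp add: LIM_zero)
    ultimately have "e \<longlonglongrightarrow> 0" unfolding e_def using tendsto_add[of _ 0 _ _ 0] by fastforce
    then have "(\<lambda>n. (\<Sum>m=1..n. cmod (f m) * \<bar>e m\<bar>) / U n) \<longlonglongrightarrow> 0"
      by (intro toeplitz_tendsto_0[OF _ l1 U(3)]) auto
    then have lim: "(\<lambda>n. cmod (\<Sum>m=1..n. f m * complex_of_real (Y m \<omega> - EY m)) / U n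
        + (\<Sum>m=1..n. cmod (f m) * \<bar>e m\<bar>) / U n) \<longlonglongrightarrow> 0"
      using tendsto_add[OF elim(1)] by fastforce
    show ?case
    proof (rule Lim_null_comparison[OF _ lim])
      show "\<forall>\<^sub>F n in sequentially.
        norm (cmod (\<Sum>m=1..n. f m * complex_of_real (Xs m \<omega> - expectation X)) / U n)
          \<le> cmod (\<Sum>m=1..n. f m * complex_of_real (Y m \<omega> - EY m)) / U n + (\<Sum>m=1..n. cmod (f m) * \<bar>e m\<bar>) / U n"
        using eventually_ge_at_top[of 1]
      proof eventually_elim
        case (elim n)
        have "(\<Sum>m=1..n. f m * complex_of_real (Xs m \<omega> - expectation X))
            = (\<Sum>m=1..n. f m * complex_of_real (Y m \<omega> - EY m)) + (\<Sum>m=1..n. f m * complex_of_real (e m))"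
          unfolding sum.distrib[symmetric] e_def by (intro sum.cong refl) (simp add: algebra_simps)
        also have "cmod \<dots> \<le> cmod (\<Sum>m=1..n. f m * complex_of_real (Y m \<omega> - EY m))
            + cmod (\<Sum>m=1..n. f m * complex_of_real (e m))"
          by (rule norm_triangle_ineq)
        also have "cmod (\<Sum>m=1..n. f m * complex_of_real (e m)) \<le> (\<Sum>m=1..n. cmod (f m) * \<bar>e m\<bar>)"
          by (rule order_trans[OF norm_sum]) (simp add: norm_mult)
        finally show ?case
          using U(1)[OF elim] unfolding add_divide_distrib[symmetric]
          by (simp add: divide_right_mono)
      qed
    qed
  qed
qed

section \<open>The constant \<open>\<eta>\<close>\<close>

text \<open>For \<open>\<rho>\<close> above 3/4 the event would force \<open>S n\<close> to exceed
  its mean by at least \<open>n / 4\<close> for every \<open>n\<close>, and Hoeffding's inequality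
  makes the probability of that exponentially small in \<open>n\<close>.\<close>

lemma eta_le_three_quarters:
  assumes "prob_space N" and indep: "prob_space.indep_vars N (\<lambda>_. borel) \<epsilon> {1..}"
    and p0: "\<And>i. 1 \<le> i \<Longrightarrow> measure N {\<omega> \<in> space N. \<epsilon> i \<omega> = 0} = 1 / 2"
    and p1: "\<And>i. 1 \<le> i \<Longrightarrow> measure N {\<omega> \<in> space N. \<epsilon> i \<omega> = 1} = 1 / 2"
  shows "eta N \<epsilon> \<le> 3 / 4"
proof -
  interpret N: prob_space N by fact
  define S where "S n \<omega> = (\<Sum>i=1..n. \<epsilon> i \<omega>)" for n \<omega>
  have meas: "\<epsilon> i \<in> borel_measurable N" if "1 \<le> i" for i
    using indep that unfolding N.indep_vars_def by auto
  have measS [measurable]: "S n \<in> borel_measurable N" for n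
    unfolding S_def by (intro borel_measurable_sum meas) auto
  have AE01: "AE \<omega> in N. \<epsilon> i \<omega> = 0 \<or> \<epsilon> i \<omega> = 1" if i: "1 \<le> i" for i
  proof -
    note [measurable] = meas[OF i]
    have "N.prob ({\<omega> \<in> space N. \<epsilon> i \<omega> = 0} \<union> {\<omega> \<in> space N. \<epsilon> i \<omega> = 1}) = 1 / 2 + 1 / 2"
      unfolding p0[OF i, symmetric] p1[OF i, symmetric]
      by (subst N.finite_measure_Union) (auto simp: p0[OF i] p1[OF i])
    then have "AE \<omega> in N. \<omega> \<in> {\<omega> \<in> space N. \<epsilon> i \<omega> = 0} \<union> {\<omega> \<in> space N. \<epsilon> i \<omega> = 1}"
      by (intro N.AE_prob_1) simp
    then show ?thesis by eventually_elim auto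
  qed
  have mean: "N.expectation (\<epsilon> i) = 1 / 2" if i: "1 \<le> i" for i
  proof -
    note [measurable] = meas[OF i]
    have "N.expectation (\<epsilon> i) = N.expectation (indicator {\<omega> \<in> space N. \<epsilon> i \<omega> = 1})"
      by (intro integral_cong_AE) (use AE01[OF i] in \<open>auto simp: indicator_def elim!: eventually_mono\<close>)
    then show ?thesis using p1[OF i] by simp
  qed
  have tails: "N.prob {\<omega> \<in> space N. S n \<omega> \<ge> real n * (3 / 4)} \<le> exp (- (real n / 8))"
    "N.prob {\<omega> \<in> space N. S n \<omega> \<le> real n / 4} \<le> exp (- (real n / 8))" if n: "1 \<le> n" for n
  proof -
    interpret H: Hoeffding_ineq N "{1..n}" \<epsilon> "\<lambda>_. 0" "\<lambda>_. 1" "real n / 2"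
    proof unfold_locales
      show "N.indep_vars (\<lambda>_. borel) \<epsilon> {1..n}" by (rule N.indep_vars_subset[OF indep]) auto
      show "AE \<omega> in N. \<epsilon> i \<omega> \<in> {0..1}" if "i \<in> {1..n}" for i
      proof -
        from that have "1 \<le> i" by simp
        from AE01[OF this] show ?thesis by eventually_elim auto
      qed
      show "real n / 2 \<equiv> \<Sum>i\<in>{1..n}. N.expectation (\<epsilon> i)" by (simp add: mean)
    qed simp
    \<comment> \<open>Hoeffding's exponent for deviation \<open>n / 4\<close> and \<open>n\<close>
      variables of range 1.\<close>
    have e: "-2 * (real n / 4)\<^sup>2 / (\<Sum>i=1..n. (1 - 0)\<^sup>2) = - (real n / 8)"
      using n by (simp add: power2_eq_square field_simps)
    have "N.prob {\<omega> \<in> space N. (\<Sum>i=1..n. \<epsilon> i \<omega>) \<ge> real n / 2 + real n / 4}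
        \<le> exp (-2 * (real n / 4)\<^sup>2 / (\<Sum>i=1..n. (1 - 0)\<^sup>2))"
      by (rule H.Hoeffding_ineq_ge) (use n in auto)
    moreover have "real n / 2 + real n / 4 = real n * (3 / 4)" by simp
    ultimately show "N.prob {\<omega> \<in> space N. S n \<omega> \<ge> real n * (3 / 4)} \<le> exp (- (real n / 8))"
      unfolding S_def e by simp
    have "N.prob {\<omega> \<in> space N. (\<Sum>i=1..n. \<epsilon> i \<omega>) \<le> real n / 2 - real n / 4}
        \<le> exp (-2 * (real n / 4)\<^sup>2 / (\<Sum>i=1..n. (1 - 0)\<^sup>2))"
      by (rule H.Hoeffding_ineq_le) (use n in auto)
    moreover have "real n / 2 - real n / 4 = real n / 4" by simp
    ultimately show "N.prob {\<omega> \<in> space N. S n \<omega> \<le> real n / 4} \<le> exp (- (real n / 8))"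
      unfolding S_def e by simp
  qed
  have INF_iff: "ereal \<rho> \<le> (INF n\<in>{1..}. ereal ((\<Sum>i=1..n. \<epsilon> i \<omega>) / real n))
      \<longleftrightarrow> (\<forall>n\<ge>1. real n * \<rho> \<le> S n \<omega>)" for \<rho> \<omega>
    unfolding le_INF_iff S_def by (auto simp: pos_le_divide_eq mult.commute)
  define R where "R = {\<rho>. 0 < \<rho> \<and> 0 < N.prob {\<omega> \<in> space N. \<forall>n\<ge>1. real n * \<rho> \<le> S n \<omega>}}"
  have eta: "eta N \<epsilon> = Sup R" unfolding eta_def R_def INF_iff ..
  have exp_pow: "exp (- (real n / 8)) = exp (- (1 / 8)) ^ n" for n
    by (simp add: exp_of_nat_mult[symmetric])
  have "\<rho> \<le> 3 / 4" if "\<rho> \<in> R" for \<rho>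
  proof (rule ccontr)
    assume \<rho>: "\<not> \<rho> \<le> 3 / 4"
    define p where "p = N.prob {\<omega> \<in> space N. \<forall>n\<ge>1. real n * \<rho> \<le> S n \<omega>}"
    have "p \<le> exp (- (1 / 8)) ^ n" if n: "1 \<le> n" for n
    proof -
      have "p \<le> N.prob {\<omega> \<in> space N. S n \<omega> \<ge> real n * (3 / 4)}"
        unfolding p_def
      proof (rule N.finite_measure_mono)
        show "{\<omega> \<in> space N. \<forall>n\<ge>1. real n * \<rho> \<le> S n \<omega>} \<subseteq> {\<omega> \<in> space N. S n \<omega> \<ge> real n * (3 / 4)}"
        proof clarify
          fix \<omega> assume "\<forall>n\<ge>1. real n * \<rho> \<le> S n \<omega>"
          then have "real n * \<rho> \<le> S n \<omega>" using n by blast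
          moreover have "real n * (3 / 4) \<le> real n * \<rho>" using \<rho> by (intro mult_left_mono) auto
          ultimately show "real n * (3 / 4) \<le> S n \<omega>" by linarith
        qed
      qed measurable
      then show ?thesis using tails(1)[OF n] unfolding exp_pow by linarith
    qed
    moreover have "(\<lambda>n. exp (- (1 / 8)) ^ n) \<longlonglongrightarrow> (0::real)"
      by (rule LIMSEQ_realpow_zero) auto
    ultimately have "p \<le> 0" by (intro LIMSEQ_le_const) auto
    then show False using that by (simp add: R_def p_def)
  qed
  txt \<open>
    The real supremum of the empty set is unspecified, so a positive lower bound is also needed.
    From some \<open>K\<close> on, \<open>S\<^sub>n > n/4\<close> holds with probability above \<open>1/2\<close>, hence also on a non-null part of
    \<open>\<epsilon>\<^sub>1 = 1\<close>, where moreover \<open>S\<^sub>n \<ge> 1\<close> for all \<open>n < K\<close>.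
  \<close>
  moreover have "R \<noteq> {}"
  proof -
    have summ: "summable (\<lambda>n. exp (- (1 / 8)) ^ n :: real)" by (rule summable_geometric) simp
    obtain K0 where "\<And>n. K0 \<le> n \<Longrightarrow> norm (\<Sum>i. exp (- (1 / 8)) ^ (i + n) :: real) < 1 / 2"
      using suminf_exist_split[OF _ summ, of "1 / 2"] by auto
    then obtain K :: nat where K: "1 \<le> K" "(\<Sum>i. exp (- (1 / 8)) ^ (i + K) :: real) < 1 / 2"
      by (metis abs_ge_self le_add1 le_add2 order_le_less_trans real_norm_def)
    define B where "B n = {\<omega> \<in> space N. S (n + K) \<omega> \<le> real (n + K) / 4}" for n
    have B_meas [measurable]: "B n \<in> sets N" for n unfolding B_def by measurable
    have B_le: "N.prob (B n) \<le> exp (- (1 / 8)) ^ (n + K)" for n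
      using tails(2)[of "n + K"] K(1) unfolding B_def exp_pow by simp
    have summK: "summable (\<lambda>n. exp (- (1 / 8)) ^ (n + K) :: real)"
      using summ by (rule summable_ignore_initial_segment)
    then have summB: "summable (\<lambda>n. N.prob (B n))"
      by (rule summable_comparison_test') (use B_le in auto)
    have "N.prob (\<Union>n. B n) \<le> (\<Sum>n. N.prob (B n))"
      by (rule N.finite_measure_subadditive_countably) (use summB in auto)
    also have "\<dots> \<le> (\<Sum>i. exp (- (1 / 8)) ^ (i + K))"
      by (rule suminf_le[OF B_le summB summK])
    finally have PB: "N.prob (\<Union>n. B n) < 1 / 2" using K(2) by linarith
    define E where "E = {\<omega> \<in> space N. \<epsilon> 1 \<omega> = 1}"
    have [measurable]: "E \<in> sets N" unfolding E_def using meas[of 1] by measurable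
    have "N.prob E \<le> N.prob (\<Union>n. B n) + N.prob (E - (\<Union>n. B n))"
      by (subst N.finite_measure_Union[symmetric]) (auto intro!: N.finite_measure_mono)
    then have pos: "0 < N.prob (E - (\<Union>n. B n))"
      using PB p1[of 1] by (simp add: E_def)
    \<comment> \<open>The part \<open>1 / K\<close> gives \<open>n * \<rho> \<le> 1\<close> for
      \<open>n < K\<close>, where \<open>S n \<ge> 1\<close>; the part \<open>1 / 4\<close> matches
      the complement of the events \<open>B\<close> for \<open>n \<ge> K\<close>.\<close>
    define \<rho> where "\<rho> = min (1 / 4) (1 / real K)"
    define H where "H = {\<omega> \<in> space N. \<forall>n\<ge>1. real n * \<rho> \<le> S n \<omega>}"
    have "H \<in> sets N" unfolding H_def by measurable
    \<comment> \<open>The inclusion in \<open>H\<close> holds only almost everywhere: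
      \<open>S n \<ge> \<epsilon> 1 \<omega>\<close> needs nonnegative summands, and these may fail
      on a null set.\<close>
    moreover have "AE \<omega> in N. \<forall>i\<in>{1..}. \<epsilon> i \<omega> = 0 \<or> \<epsilon> i \<omega> = 1"
      by (rule AE_ball_countable') (use AE01 in auto)
    then have "AE \<omega> in N. \<omega> \<in> E - (\<Union>n. B n) \<longrightarrow> \<omega> \<in> H"
    proof eventually_elim
      case (elim \<omega>)
      show ?case
      proof
        assume \<omega>: "\<omega> \<in> E - (\<Union>n. B n)"
        have "real n * \<rho> \<le> S n \<omega>" if n: "1 \<le> n" for n
        proof (cases "n < K")
          case True
          have "real n * \<rho> \<le> real K * (1 / real K)"
            using True K(1) by (intro mult_mono) (auto simp: \<rho>_def)
          also have "\<dots> = (\<Sum>i\<in>{1}. \<epsilon> i \<omega>)" using \<omega> K(1) by (simp add: E_def)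
          also have "\<dots> \<le> S n \<omega>"
            unfolding S_def
          proof (rule sum_mono2)
            fix i assume "i \<in> {1..n} - {1}"
            then have "\<epsilon> i \<omega> = 0 \<or> \<epsilon> i \<omega> = 1" using elim by simp
            then show "0 \<le> \<epsilon> i \<omega>" by auto
          qed (use n in auto)
          finally show ?thesis .
        next
          case False
          then have "\<omega> \<notin> B (n - K)" "n - K + K = n" using \<omega> by auto
          then have "real n / 4 < S n \<omega>" using \<omega> by (simp add: B_def E_def)
          moreover have "real n * \<rho> \<le> real n * (1 / 4)"
            by (intro mult_left_mono) (auto simp: \<rho>_def)
          ultimately show ?thesis by linarith
        qed
        then show "\<omega> \<in> H" using \<omega> by (simp add: H_def E_def)
      qed
    qed
    ultimately have "N.prob (E - (\<Union>n. B n)) \<le> N.prob H"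
      by (intro N.finite_measure_mono_AE)
    then have "\<rho> \<in> R" using pos K(1) by (simp add: R_def H_def \<rho>_def)
    then show ?thesis by auto
  qed
  ultimately show ?thesis unfolding eta by (intro cSup_least) auto
qed

section \<open>From normalization by \<open>U\<close> to normalization by the summatory
  function\<close>

theorem theorem1p2:
  fixes f :: "nat \<Rightarrow> complex"
    and N :: "'b measure" and \<epsilon> :: "nat \<Rightarrow> 'b \<Rightarrow> real"
    and U :: "nat \<Rightarrow> real" and c\<^sub>1 c\<^sub>2 h :: real
    and M :: "'a measure" and X :: "'a \<Rightarrow> real" and Xs :: "nat \<Rightarrow> 'a \<Rightarrow> real"
  assumes "prob_space N"
    and "prob_space.indep_vars N (\<lambda>_. borel) \<epsilon> {1..}"
    and "\<And>i. 1 \<le> i \<Longrightarrow> measure N {\<omega> \<in> space N. \<epsilon> i \<omega> = 0} = 1 / 2"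
    and "\<And>i. 1 \<le> i \<Longrightarrow> measure N {\<omega> \<in> space N. \<epsilon> i \<omega> = 1} = 1 / 2"
    and "strongly_additive f"
    and "\<And>n. 1 \<le> n \<Longrightarrow> 0 \<le> U n"
    and "mono_on {1..} U"
    and "filterlim U at_top sequentially"
    and "0 < c\<^sub>1" and "0 < c\<^sub>2"
    and "\<And>n. 1 \<le> n \<Longrightarrow> c\<^sub>1 * U n \<le> cmod (summatory f (real n)) \<and> cmod (summatory f (real n)) \<le> c\<^sub>2 * U n"
    and "0 < h" and "h < 1 / 4"
    and "(\<lambda>n. SUP p\<in>{p. prime p \<and> real n powr h < real p \<and> p \<le> n}. cmod (f p))
           \<in> O(\<lambda>n. cmod (summatory f (eta N \<epsilon> * real n)) / real n)"
    and "(\<lambda>n. abs_prime_sum f (real n powr h)) \<in> O(\<lambda>n. cmod (summatory f (eta N \<epsilon> * real n)) / real n)"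
    and "(\<lambda>n. sqrt (prime_square_sum f (real n powr h))) \<in> O(\<lambda>n. cmod (summatory f (eta N \<epsilon> * real n)) / real n)"
    and "prob_space M"
    and "prob_space.indep_vars M (\<lambda>_. borel) Xs {1..}"
    and "X \<in> borel_measurable M"
    and "\<And>m. 1 \<le> m \<Longrightarrow> distr M borel (Xs m) = distr M borel X"
    and "integrable M X"
  shows "AE \<omega> in M.
    (\<lambda>n. (\<Sum>m=1..n. f m * complex_of_real (Xs m \<omega>)) / summatory f (real n))
      \<longlonglongrightarrow> complex_of_real (prob_space.expectation M X)"
proof -
  interpret M: prob_space M by fact
  have F: "\<And>n. 1 \<le> n \<Longrightarrow> cmod (summatory f (real n)) \<le> c\<^sub>2 * U n" using assms(11) by blast
  obtain C where C: "0 < C" "\<forall>\<^sub>F K in sequentially. \<forall>n\<ge>1. eta N \<epsilon> * real K \<le> real n \<longrightarrow>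
      (\<Sum>m=1..K. (cmod (f m))\<^sup>2) \<le> C * (U n)\<^sup>2 / real K"
    using second_moment_bound[OF assms(5,12,13,6,7,10) F assms(14,15,16)] by blast
  have eta: "eta N \<epsilon> \<le> 3 / 4" by (rule eta_le_three_quarters[OF assms(1-4)])
  \<comment> \<open>Every \<open>n\<close> beyond \<open>3 / 4 * K\<close> is also beyond
    \<open>eta N \<epsilon> * K\<close>.\<close>
  have C': "\<forall>\<^sub>F K in sequentially. \<forall>n\<ge>1. 3 / 4 * real K \<le> real n \<longrightarrow>
      (\<Sum>m=1..K. (cmod (f m))\<^sup>2) \<le> C * (U n)\<^sup>2 / real K"
    using C(2)
  proof eventually_elim
    case (elim K)
    have "eta N \<epsilon> * real K \<le> 3 / 4 * real K" using eta by (rule mult_right_mono) simp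
    then show ?case using elim by (meson order_trans)
  qed
  have "AE \<omega> in M. (\<lambda>n. cmod (\<Sum>m=1..n. f m * complex_of_real (Xs m \<omega> - M.expectation X)) / U n) \<longlonglongrightarrow> 0"
    by (rule M.weighted_slln[OF assms(6-8) C(1) C' assms(18-21)])
  then show ?thesis
  proof eventually_elim
    case (elim \<omega>)
    have U_pos: "\<forall>\<^sub>F n in sequentially. 0 < U n"
      using assms(8) by (simp add: filterlim_at_top_dense)
    \<comment> \<open>The lower bound by \<open>U\<close> makes division by the summatory function
      cost only the factor \<open>1 / c\<^sub>1\<close>.\<close>
    have lim: "(\<lambda>n. 1 / c\<^sub>1 * (cmod (\<Sum>m=1..n. f m * complex_of_real (Xs m \<omega> - M.expectation X)) / U n)) \<longlonglongrightarrow> 0"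
      using tendsto_mult_right_zero[OF elim] .
    have "(\<lambda>n. (\<Sum>m=1..n. f m * complex_of_real (Xs m \<omega>)) / summatory f (real n)
        - complex_of_real (M.expectation X)) \<longlonglongrightarrow> 0"
    proof (rule Lim_null_comparison[OF _ lim])
      show "\<forall>\<^sub>F n in sequentially.
        norm ((\<Sum>m=1..n. f m * complex_of_real (Xs m \<omega>)) / summatory f (real n) - complex_of_real (M.expectation X))
        \<le> 1 / c\<^sub>1 * (cmod (\<Sum>m=1..n. f m * complex_of_real (Xs m \<omega> - M.expectation X)) / U n)"
        using U_pos eventually_ge_at_top[of 1]
      proof eventually_elim
        case (elim n)
        have pos: "0 < c\<^sub>1 * U n" using elim assms(9) by simp
        have lb: "c\<^sub>1 * U n \<le> cmod (summatory f (real n))" using assms(11)[OF elim(2)] by blast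
        then have nz: "summatory f (real n) \<noteq> 0" using pos by auto
        have "{m. 1 \<le> m \<and> real m \<le> real n} = {1..n}" by auto
        then have Fn: "summatory f (real n) = (\<Sum>m=1..n. f m)" by (simp add: summatory_def)
        have "(\<Sum>m=1..n. f m * complex_of_real (Xs m \<omega>)) / summatory f (real n) - complex_of_real (M.expectation X)
            = ((\<Sum>m=1..n. f m * complex_of_real (Xs m \<omega>)) - summatory f (real n) * complex_of_real (M.expectation X))
              / summatory f (real n)"
          using nz by (simp add: diff_divide_distrib)
        \<comment> \<open>The weights sum to the summatory function itself, so subtracting the limit
          centres every variable.\<close>
        also have "(\<Sum>m=1..n. f m * complex_of_real (Xs m \<omega>)) - summatory f (real n) * complex_of_real (M.expectation X)
            = (\<Sum>m=1..n. f m * complex_of_real (Xs m \<omega> - M.expectation X))"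
          unfolding Fn by (simp add: sum_distrib_right sum_subtractf right_diff_distrib)
        finally have "norm ((\<Sum>m=1..n. f m * complex_of_real (Xs m \<omega>)) / summatory f (real n) - complex_of_real (M.expectation X))
            = cmod (\<Sum>m=1..n. f m * complex_of_real (Xs m \<omega> - M.expectation X)) / cmod (summatory f (real n))"
          by (simp only: norm_divide)
        also have "\<dots> \<le> cmod (\<Sum>m=1..n. f m * complex_of_real (Xs m \<omega> - M.expectation X)) / (c\<^sub>1 * U n)"
          using nz by (intro divide_left_mono[OF lb] mult_pos_pos[OF _ pos]) auto
        finally show ?case by simp
      qed
    qed
    then show ?case by (simp add: LIM_zero_iff)
  qed
qed


end
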